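(* If the orbit $\mathcal O$ is finite, then $(x,y)$ admits a decoupling in the orbit with rational coefficients: there exist $0$-chains $\widetilde\gamma_x,\widetilde\gamma_y,\alpha$ with coefficients in $\mathbb Q$ such that $(x,y)=\widetilde\gamma_x+\widetilde\gamma_y+\alpha$ (as $0$-chains), $\sigma\cdot\widetilde\gamma_x=\widetilde\gamma_x$ for all $\sigma\in G_x$, $\sigma\cdot\widetilde\gamma_y=\widetilde\gamma_y$ for all $\sigma\in G_y$, and $\alpha$ cancels decoupled fractions.
   Context: Fix a finite set $\mathcal S\subset\mathbb Z^2$ and nonzero complex weights $(w_s)_{s\in\mathcal S}$; step polynomial $S(X,Y)=\sum_{(i,j)\in\mathcal S}w_{(i,j)}X^iY^j$. Let $-m_x,M_x$ (resp. $-m_y,M_y$) be the smallest and largest exponents of $X$ (resp. $Y$) in $S$, assumed to satisfy $m_x,M_x,m_y,M_y>0$; the kernel polynomial is $\widetilde K(X,Y,t)=X^{m_x}Y^{m_y}(1-tS(X,Y))\in\mathbb C[X,Y,t]$. Let $x,y$ be algebraically independent over $\mathbb C$, $k=\mathbb C(S(x,y))$, $\mathbb K$ an algebraic closure of $\mathbb C(x,y)$. Write $(u,v)\sim^x(u',v')$ if $u=u'$ and $S(u,v)=S(u',v')$, and $(u,v)\sim^y(u',v')$ if $v=v'$ and $S(u,v)=S(u',v')$; the orbit $\mathcal O$ is the equivalence class of $(x,y)$ for the equivalence relation generated by $\sim^x,\sim^y$. Let $k(\mathcal O)\subset\mathbb K$ be generated over $k$ by the coordinates of pairs of $\mathcal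 O$; $G_x=\mathrm{Aut}(k(\mathcal O)|k(x))$, $G_y=\mathrm{Aut}(k(\mathcal O)|k(y))$; they act on pairs coordinatewise and preserve $\mathcal O$. A $0$-chain is a formal $\mathbb C$-linear combination with finite support of elements of $\mathcal O$; automorphisms act on $0$-chains by linearity. A fraction $H=A/B\in\mathbb C(X,Y,t)$ with $A,B$ coprime polynomials is regular if $\widetilde K$ does not divide $B$ in $\mathbb C[X,Y,t]$; for $(u,v)\in\mathcal O$ set $H_{(u,v)}=H(u,v,1/S(x,y))\in\mathbb K$ (well defined for regular $H$), extended linearly to $0$-chains: $H_{\sum c_a a}=\sum c_aH_a$. A $0$-chain $\alpha$ cancels decoupled fractions if $H_\alpha=0$ for every $H\in\mathbb C(X,t)+\mathbb C(Y,t)$. *)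

theory Defs
  imports
    "HOL-Computational_Algebra.Computational_Algebra"
    "HOL-Computational_Algebra.Field_as_Ring"
    "HOL-Library.Poly_Mapping"
    "HOL-Library.FuncSet"
begin

subsection \<open>Fields inside an ambient field\<close>

definition subfield_set :: "'k::field set \<Rightarrow> bool" where
  "subfield_set F \<longleftrightarrow> 0 \<in> F \<and> 1 \<in> F \<and>
     (\<forall>a\<in>F. \<forall>b\<in>F. a + b \<in> F \<and> a * b \<in> F) \<and>
     (\<forall>a\<in>F. - a \<in> F \<and> inverse a \<in> F)"

definition field_embedding :: "('a::field \<Rightarrow> 'k::field) \<Rightarrow> bool" where
  "field_embedding \<iota> \<longleftrightarrow> \<iota> 1 = 1 \<and>
     (\<forall>a b. \<iota> (a + b) = \<iota> a + \<iota> b) \<and> (\<forall>a b. \<iota> (a * b) = \<iota> a * \<iota> b)"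

definition algebraic_over :: "'k::field set \<Rightarrow> 'k \<Rightarrow> bool" where
  "algebraic_over F z \<longleftrightarrow> (\<exists>p. p \<noteq> 0 \<and> (\<forall>n. poly.coeff p n \<in> F) \<and> poly p z = 0)"

text \<open>
  The group of automorphisms of the subfield \<open>L\<close> fixing \<open>F\<close> pointwise. Extensionality makes the
  representation of an automorphism by a function on the ambient type unique.
\<close>
definition field_aut :: "'k::field set \<Rightarrow> 'k set \<Rightarrow> ('k \<Rightarrow> 'k) set" where
  "field_aut L F = {\<sigma> \<in> extensional L. bij_betw \<sigma> L L \<and>
     (\<forall>a\<in>L. \<forall>b\<in>L. \<sigma> (a + b) = \<sigma> a + \<sigma> b \<and> \<sigma> (a * b) = \<sigma> a * \<sigma> b) \<and>
     (\<forall>a\<in>F. \<sigma> a = a)}"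

subsection \<open>Polynomials and fractions in several variables\<close>

text \<open>
  \<open>\<complex>[X,Y]\<close> is \<open>complex poly poly\<close> and \<open>\<complex>[X,Y,t]\<close> is \<open>complex poly poly poly\<close>, with \<open>X\<close> the innermost
  variable, then \<open>Y\<close>, then \<open>t\<close>. The map \<open>\<iota>\<close> is the inclusion of the field of coefficients.
\<close>

definition eval2 :: "(complex \<Rightarrow> 'k::field) \<Rightarrow> complex poly poly \<Rightarrow> 'k \<Rightarrow> 'k \<Rightarrow> 'k" where
  "eval2 \<iota> p u v = poly (map_poly (\<lambda>q. poly (map_poly \<iota> q) u) p) v"

definition eval3 :: "(complex \<Rightarrow> 'k::field) \<Rightarrow> complex poly poly poly \<Rightarrow> 'k \<Rightarrow> 'k \<Rightarrow> 'k \<Rightarrow> 'k" where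
  "eval3 \<iota> p u v t = poly (map_poly (\<lambda>q. eval2 \<iota> q u v) p) t"

definition alg_independent2 :: "(complex \<Rightarrow> 'k::field) \<Rightarrow> 'k \<Rightarrow> 'k \<Rightarrow> bool" where
  "alg_independent2 \<iota> x y \<longleftrightarrow> (\<forall>p. p \<noteq> 0 \<longrightarrow> eval2 \<iota> p x y \<noteq> 0)"

text \<open>The subrings \<open>\<complex>[X,t]\<close> and \<open>\<complex>[Y,t]\<close> of \<open>\<complex>[X,Y,t]\<close>.\<close>

definition polys_Xt :: "complex poly poly poly set" where
  "polys_Xt = {p. \<forall>n. degree (poly.coeff p n) = 0}"

definition polys_Yt :: "complex poly poly poly set" where
  "polys_Yt = {p. \<forall>n m. degree (poly.coeff (poly.coeff p n) m) = 0}"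

definition fracs :: "complex poly poly poly set \<Rightarrow> complex poly poly poly fract set" where
  "fracs R = {Fract A B | A B. A \<in> R \<and> B \<in> R \<and> B \<noteq> 0}"

definition decoupled_fracs :: "complex poly poly poly fract set" where
  "decoupled_fracs = {F + G | F G. F \<in> fracs polys_Xt \<and> G \<in> fracs polys_Yt}"

subsection \<open>Weighted steps and the kernel polynomial\<close>

text \<open>\<open>m\<^sub>x\<close>, \<open>M\<^sub>x\<close>, \<open>m\<^sub>y\<close>, \<open>M\<^sub>y\<close>: only meaningful for finite nonempty step sets (and nonzero weights).\<close>

definition m_x :: "(int \<times> int) set \<Rightarrow> int" where "m_x \<S> = - Min (fst ` \<S>)"
definition M_x :: "(int \<times> int) set \<Rightarrow> int" where "M_x \<S> = Max (fst ` \<S>)"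
definition m_y :: "(int \<times> int) set \<Rightarrow> int" where "m_y \<S> = - Min (snd ` \<S>)"
definition M_y :: "(int \<times> int) set \<Rightarrow> int" where "M_y \<S> = Max (snd ` \<S>)"

definition step_poly ::
  "(complex \<Rightarrow> 'k::field) \<Rightarrow> (int \<times> int) set \<Rightarrow> (int \<times> int \<Rightarrow> complex) \<Rightarrow> 'k \<Rightarrow> 'k \<Rightarrow> 'k" where
  "step_poly \<iota> \<S> w u v = (\<Sum>(i, j)\<in>\<S>. \<iota> (w (i, j)) * u powi i * v powi j)"

text \<open>\<open>X\<^sup>m\<^sup>x Y\<^sup>m\<^sup>y (1 - t S(X,Y))\<close>, with the monomial factor multiplied into the Laurent polynomial \<open>S\<close>.\<close>

definition kernel_poly ::
  "(int \<times> int) set \<Rightarrow> (int \<times> int \<Rightarrow> complex) \<Rightarrow> complex poly poly poly" where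
  "kernel_poly \<S> w =
     monom (monom (monom 1 (nat (m_x \<S>))) (nat (m_y \<S>))) 0
     - (\<Sum>(i, j)\<in>\<S>. monom (monom (monom (w (i, j)) (nat (i + m_x \<S>))) (nat (j + m_y \<S>))) 1)"

definition regular_frac ::
  "(int \<times> int) set \<Rightarrow> (int \<times> int \<Rightarrow> complex) \<Rightarrow> complex poly poly poly fract \<Rightarrow> bool" where
  "regular_frac \<S> w H \<longleftrightarrow> \<not> kernel_poly \<S> w dvd snd (quot_of_fract H)"

subsection \<open>The orbit and its Galois groups\<close>

text \<open>
  \<open>S(u,v)\<close> only makes sense for nonzero \<open>u\<close> and \<open>v\<close>, since \<open>S\<close> has negative exponents in both
  variables; the relations are therefore restricted to pairs of nonzero elements.
\<close>

definition sim_x ::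
  "(complex \<Rightarrow> 'k::field) \<Rightarrow> (int \<times> int) set \<Rightarrow> (int \<times> int \<Rightarrow> complex) \<Rightarrow> 'k \<times> 'k \<Rightarrow> 'k \<times> 'k \<Rightarrow> bool" where
  "sim_x \<iota> \<S> w = (\<lambda>(u, v) (u', v'). u \<noteq> 0 \<and> v \<noteq> 0 \<and> u' \<noteq> 0 \<and> v' \<noteq> 0 \<and>
     u = u' \<and> step_poly \<iota> \<S> w u v = step_poly \<iota> \<S> w u' v')"

definition sim_y ::
  "(complex \<Rightarrow> 'k::field) \<Rightarrow> (int \<times> int) set \<Rightarrow> (int \<times> int \<Rightarrow> complex) \<Rightarrow> 'k \<times> 'k \<Rightarrow> 'k \<times> 'k \<Rightarrow> bool" where
  "sim_y \<iota> \<S> w = (\<lambda>(u, v) (u', v'). u \<noteq> 0 \<and> v \<noteq> 0 \<and> u' \<noteq> 0 \<and> v' \<noteq> 0 \<and>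
     v = v' \<and> step_poly \<iota> \<S> w u v = step_poly \<iota> \<S> w u' v')"

definition orbit ::
  "(complex \<Rightarrow> 'k::field) \<Rightarrow> (int \<times> int) set \<Rightarrow> (int \<times> int \<Rightarrow> complex) \<Rightarrow> 'k \<Rightarrow> 'k \<Rightarrow> ('k \<times> 'k) set" where
  "orbit \<iota> \<S> w x y = {a. equivclp (\<lambda>b c. sim_x \<iota> \<S> w b c \<or> sim_y \<iota> \<S> w b c) (x, y) a}"

definition base_field ::
  "(complex \<Rightarrow> 'k::field) \<Rightarrow> (int \<times> int) set \<Rightarrow> (int \<times> int \<Rightarrow> complex) \<Rightarrow> 'k \<Rightarrow> 'k \<Rightarrow> 'k set" where
  "base_field \<iota> \<S> w x y = subfield_set hull (range \<iota> \<union> {step_poly \<iota> \<S> w x y})"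

definition orbit_field ::
  "(complex \<Rightarrow> 'k::field) \<Rightarrow> (int \<times> int) set \<Rightarrow> (int \<times> int \<Rightarrow> complex) \<Rightarrow> 'k \<Rightarrow> 'k \<Rightarrow> 'k set" where
  "orbit_field \<iota> \<S> w x y = subfield_set hull
     (base_field \<iota> \<S> w x y \<union> fst ` orbit \<iota> \<S> w x y \<union> snd ` orbit \<iota> \<S> w x y)"

definition G_x ::
  "(complex \<Rightarrow> 'k::field) \<Rightarrow> (int \<times> int) set \<Rightarrow> (int \<times> int \<Rightarrow> complex) \<Rightarrow> 'k \<Rightarrow> 'k \<Rightarrow> ('k \<Rightarrow> 'k) set" where
  "G_x \<iota> \<S> w x y =
     field_aut (orbit_field \<iota> \<S> w x y) (subfield_set hull (base_field \<iota> \<S> w x y \<union> {x}))"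

definition G_y ::
  "(complex \<Rightarrow> 'k::field) \<Rightarrow> (int \<times> int) set \<Rightarrow> (int \<times> int \<Rightarrow> complex) \<Rightarrow> 'k \<Rightarrow> 'k \<Rightarrow> ('k \<Rightarrow> 'k) set" where
  "G_y \<iota> \<S> w x y =
     field_aut (orbit_field \<iota> \<S> w x y) (subfield_set hull (base_field \<iota> \<S> w x y \<union> {y}))"

subsection \<open>Chains\<close>

text \<open>
  Finitely supported formal \<open>\<complex>\<close>-linear combinations of pairs are elements of
  \<open>('k \<times> 'k) \<Rightarrow>\<^sub>0 complex\<close>; the pair \<open>a\<close> itself is \<open>Poly_Mapping.single a 1\<close>.
\<close>

definition zero_chains ::
  "(complex \<Rightarrow> 'k::field) \<Rightarrow> (int \<times> int) set \<Rightarrow> (int \<times> int \<Rightarrow> complex) \<Rightarrow> 'k \<Rightarrow> 'k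
    \<Rightarrow> (('k \<times> 'k) \<Rightarrow>\<^sub>0 complex) set" where
  "zero_chains \<iota> \<S> w x y = {\<alpha>. Poly_Mapping.keys \<alpha> \<subseteq> orbit \<iota> \<S> w x y}"

definition rational_coeffs :: "('b \<Rightarrow>\<^sub>0 complex) \<Rightarrow> bool" where
  "rational_coeffs \<alpha> \<longleftrightarrow> (\<forall>a. Poly_Mapping.lookup \<alpha> a \<in> \<rat>)"

definition chain_act :: "('k \<Rightarrow> 'k) \<Rightarrow> (('k \<times> 'k) \<Rightarrow>\<^sub>0 complex) \<Rightarrow> (('k \<times> 'k) \<Rightarrow>\<^sub>0 complex)" where
  "chain_act \<sigma> \<alpha> = (\<Sum>a\<in>Poly_Mapping.keys \<alpha>.
     Poly_Mapping.single (map_prod \<sigma> \<sigma> a) (Poly_Mapping.lookup \<alpha> a))"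

text \<open>\<open>quot_of_fract\<close> returns the numerator and denominator of a reduced representation.\<close>

definition frac_at ::
  "(complex \<Rightarrow> 'k::field) \<Rightarrow> (int \<times> int) set \<Rightarrow> (int \<times> int \<Rightarrow> complex) \<Rightarrow> 'k \<Rightarrow> 'k
    \<Rightarrow> complex poly poly poly fract \<Rightarrow> 'k \<times> 'k \<Rightarrow> 'k" where
  "frac_at \<iota> \<S> w x y H = (\<lambda>(u, v).
     if regular_frac \<S> w H
     then eval3 \<iota> (fst (quot_of_fract H)) u v (1 / step_poly \<iota> \<S> w x y)
          / eval3 \<iota> (snd (quot_of_fract H)) u v (1 / step_poly \<iota> \<S> w x y)
     else undefined)"

definition frac_at_chain ::
  "(complex \<Rightarrow> 'k::field) \<Rightarrow> (int \<times> int) set \<Rightarrow> (int \<times> int \<Rightarrow> complex) \<Rightarrow> 'k \<Rightarrow> 'k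
    \<Rightarrow> complex poly poly poly fract \<Rightarrow> (('k \<times> 'k) \<Rightarrow>\<^sub>0 complex) \<Rightarrow> 'k" where
  "frac_at_chain \<iota> \<S> w x y H \<alpha> =
     (\<Sum>a\<in>Poly_Mapping.keys \<alpha>. \<iota> (Poly_Mapping.lookup \<alpha> a) * frac_at \<iota> \<S> w x y H a)"

definition cancels_decoupled ::
  "(complex \<Rightarrow> 'k::field) \<Rightarrow> (int \<times> int) set \<Rightarrow> (int \<times> int \<Rightarrow> complex) \<Rightarrow> 'k \<Rightarrow> 'k
    \<Rightarrow> (('k \<times> 'k) \<Rightarrow>\<^sub>0 complex) \<Rightarrow> bool" where
  "cancels_decoupled \<iota> \<S> w x y \<alpha> \<longleftrightarrow>
     (\<forall>H\<in>decoupled_fracs. frac_at_chain \<iota> \<S> w x y H \<alpha> = 0)"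

end

theory Submission
  imports Defs
begin

text \<open>
  View the orbit as the edge set of a connected bipartite graph whose vertices are the first and the
  second coordinates of its pairs. A chain cancels decoupled fractions once its sum over the edges at
  every vertex vanishes, that is, once its (unsigned) boundary is zero. The boundary of \<open>(x,y)\<close> is
  \<open>[x] + [y] = ([x] + U) + ([y] - U)\<close>, where \<open>U\<close> is the uniform distribution on the second
  coordinates. By connectedness both summands are boundaries of rational chains; as the first one is
  fixed by every graph automorphism fixing \<open>x\<close> and the second one by those fixing \<open>y\<close>, averaging
  makes these chains invariant under \<open>G\<^sub>x\<close> and \<open>G\<^sub>y\<close>.

  Evaluating a decoupled fraction at \<open>(u,v)\<close> requires that \<open>u\<close> and \<open>v\<close> are each algebraically
  independent of \<open>S(x,y)\<close>. This holds at \<open>(x,y)\<close> for degree reasons and propagates along the orbit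
  since \<open>(u,v)\<close> is independent iff \<open>(u,S(u,v))\<close> is.
\<close>

subsection \<open>Decoupling an edge of a bipartite graph\<close>

text \<open>Automorphisms of the bipartite graph, encoded as permutations of edges rather than of
  vertices. When \<open>Q\<close> says that an edge meets a given vertex, this is the stabiliser of
  that vertex. The group is finite because \<open>E\<close> is, and invariance under it will imply
  invariance under the Galois groups.\<close>

definition line_auts ::
  "('a \<times> 'b) set \<Rightarrow> ('a \<times> 'b \<Rightarrow> bool) \<Rightarrow> ('a \<times> 'b \<Rightarrow> 'a \<times> 'b) set" where
  "line_auts E Q = {p \<in> extensional E. bij_betw p E E \<and>
     (\<forall>a\<in>E. \<forall>b\<in>E. (fst (p a) = fst (p b) \<longleftrightarrow> fst a = fst b) \<and> (snd (p a) = snd (p b) \<longleftrightarrow> snd a = snd b)) \<and>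
     (\<forall>a\<in>E. Q (p a) \<longleftrightarrow> Q a)}"

lemma line_auts_mem: "p \<in> line_auts E Q \<Longrightarrow> a \<in> E \<Longrightarrow> p a \<in> E"
  unfolding line_auts_def using bij_betw_apply by fastforce

lemma finite_line_auts: "finite E \<Longrightarrow> finite (line_auts E Q)"
  by (rule finite_subset[of _ "E \<rightarrow>\<^sub>E E"])
     (auto simp: finite_PiE PiE_iff line_auts_def bij_betw_apply extensional_def)

lemma line_auts_nonempty: "line_auts E Q \<noteq> {}"
proof -
  have "restrict id E \<in> line_auts E Q"
    unfolding line_auts_def by (auto simp: bij_betw_def inj_on_def)
  then show ?thesis by blast
qed

lemma line_auts_compose:
  assumes p: "p \<in> line_auts E Q" and q: "q \<in> line_auts E Q"
  shows "compose E p q \<in> line_auts E Q"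
proof -
  have "q a \<in> E" if "a \<in> E" for a using line_auts_mem[OF q that] .
  moreover have "bij_betw (compose E p q) E E"
    using p q bij_betw_compose unfolding line_auts_def by blast
  ultimately show ?thesis
    using p q unfolding line_auts_def by (simp add: compose_eq compose_extensional)
qed

text \<open>Right translation by \<open>q\<close> is injective because \<open>q\<close> is onto
  \<open>E\<close>, and an injective self-map of a finite set is a bijection.\<close>

lemma line_auts_permute:
  assumes fin: "finite E" and q: "q \<in> line_auts E Q"
  shows "bij_betw (\<lambda>p. compose E p q) (line_auts E Q) (line_auts E Q)"
proof -
  have "inj_on (\<lambda>p. compose E p q) (line_auts E Q)"
  proof (rule inj_onI)
    fix p p' assume p: "p \<in> line_auts E Q" "p' \<in> line_auts E Q" and eq: "compose E p q = compose E p' q"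
    have "p b = p' b" if "b \<in> E" for b
    proof -
      obtain a where "a \<in> E" "b = q a"
        using q \<open>b \<in> E\<close> unfolding line_auts_def bij_betw_def by blast
      then show ?thesis using fun_cong[OF eq, of a] by (simp add: compose_eq)
    qed
    then show "p = p'" using p unfolding line_auts_def by (auto intro: extensionalityI)
  qed
  moreover have "(\<lambda>p. compose E p q) ` line_auts E Q \<subseteq> line_auts E Q"
    using line_auts_compose q by blast
  ultimately show ?thesis
    using finite_line_auts[OF fin] by (simp add: bij_betw_def endo_inj_surj)
qed

section \<open>Averaging over graph automorphisms\<close>

definition line_average ::
  "('a \<times> 'b) set \<Rightarrow> ('a \<times> 'b \<Rightarrow> bool) \<Rightarrow> ('a \<times> 'b \<Rightarrow> 'c::field_char_0) \<Rightarrow> 'a \<times> 'b \<Rightarrow> 'c" where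
  "line_average E Q f a = (\<Sum>p\<in>line_auts E Q. f (p a)) / of_nat (card (line_auts E Q))"

text \<open>Right translation by \<open>q\<close> merely permutes the terms of the average.\<close>

lemma line_average_invariant:
  assumes "finite E" and "q \<in> line_auts E Q" and "a \<in> E"
  shows "line_average E Q f (q a) = line_average E Q f a"
proof -
  have "(\<Sum>p\<in>line_auts E Q. f (p (q a))) = (\<Sum>p\<in>line_auts E Q. f (compose E p q a))"
    using \<open>a \<in> E\<close> by (simp add: compose_eq)
  also have "\<dots> = (\<Sum>p\<in>line_auts E Q. f (p a))"
    using sum.reindex_bij_betw[OF line_auts_permute[OF assms(1,2)], of "\<lambda>p. f (p a)"] .
  finally show ?thesis by (simp add: line_average_def)
qed

text \<open>Averaging keeps an invariant boundary: \<open>lab\<close> stands for \<open>fst\<close>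
  or \<open>snd\<close>, \<open>c\<close> for the prescribed line sums. Each \<open>p\<close>
  carries the line through \<open>e\<close> onto the line through \<open>p e\<close>, where the sum
  is \<open>c (p e) = c e\<close>, so every translate of \<open>f\<close> has the same line sums as
  \<open>f\<close>.\<close>

lemma line_average_line_sum:
  fixes f :: "'a \<times> 'b \<Rightarrow> 'c::field_char_0" and lab :: "'a \<times> 'b \<Rightarrow> 'l"
  assumes fin: "finite E"
    and lab: "\<And>p a b. p \<in> line_auts E Q \<Longrightarrow> a \<in> E \<Longrightarrow> b \<in> E \<Longrightarrow> lab (p a) = lab (p b) \<longleftrightarrow> lab a = lab b"
    and c: "\<And>p a. p \<in> line_auts E Q \<Longrightarrow> a \<in> E \<Longrightarrow> c (p a) = c a"
    and f: "\<And>e. e \<in> E \<Longrightarrow> (\<Sum>a\<in>{a\<in>E. lab a = lab e}. f a) = c e"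
    and e: "e \<in> E"
  shows "(\<Sum>a\<in>{a\<in>E. lab a = lab e}. line_average E Q f a) = c e"
proof -
  have *: "(\<Sum>a\<in>{a\<in>E. lab a = lab e}. f (p a)) = c e" if p: "p \<in> line_auts E Q" for p
  proof -
    have bij: "bij_betw p E E" using p unfolding line_auts_def by blast
    have "p ` {a\<in>E. lab a = lab e} = {b\<in>E. lab b = lab (p e)}"
    proof (intro equalityI subsetI)
      fix b assume "b \<in> {b\<in>E. lab b = lab (p e)}"
      moreover then obtain a where "a \<in> E" "b = p a" using bij unfolding bij_betw_def by blast
      ultimately show "b \<in> p ` {a\<in>E. lab a = lab e}" using lab[OF p _ e] by auto
    qed (use lab[OF p _ e] line_auts_mem[OF p] in auto)
    moreover have "inj_on p {a\<in>E. lab a = lab e}"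
      using bij unfolding bij_betw_def inj_on_def by blast
    ultimately have "(\<Sum>a\<in>{a\<in>E. lab a = lab e}. f (p a)) = (\<Sum>b\<in>{b\<in>E. lab b = lab (p e)}. f b)"
      using sum.reindex[of p "{a\<in>E. lab a = lab e}" f] by simp
    then show ?thesis using f[OF line_auts_mem[OF p e]] c[OF p e] by simp
  qed
  have "(\<Sum>a\<in>{a\<in>E. lab a = lab e}. line_average E Q f a)
      = (\<Sum>p\<in>line_auts E Q. \<Sum>a\<in>{a\<in>E. lab a = lab e}. f (p a)) / of_nat (card (line_auts E Q))"
    unfolding line_average_def sum_divide_distrib[symmetric] by (subst sum.swap) simp
  also have "\<dots> = c e"
    using line_auts_nonempty[of E Q] finite_line_auts[OF fin, of Q] by (simp add: *)
  finally show ?thesis .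
qed

section \<open>Boundaries on a connected bipartite graph\<close>

text \<open>The chain \<open>f\<close> is built along a path of edges from \<open>e0\<close> to
  \<open>b\<close>; its boundary is \<open>[snd b] - [snd e0]\<close>. A step between edges with the
  same second coordinate changes nothing.\<close>

lemma connected_row_difference:
  fixes r :: "'a \<times> 'b \<Rightarrow> 'a \<times> 'b \<Rightarrow> bool"
  assumes r: "\<And>a b. r a b \<Longrightarrow> fst a = fst b \<or> snd a = snd b"
    and E: "E = {a. equivclp r e0 a}" and fin: "finite E" and b: "b \<in> E"
  shows "\<exists>f :: 'a \<times> 'b \<Rightarrow> rat. (\<forall>e\<in>E. (\<Sum>a\<in>{a\<in>E. fst a = fst e}. f a) = 0) \<and>
     (\<forall>e\<in>E. (\<Sum>a\<in>{a\<in>E. snd a = snd e}. f a) = of_bool (snd e = snd b) - of_bool (snd e0 = snd e))"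
proof -
  have "equivclp r e0 b" using b E by simp
  then show ?thesis
  proof (induction rule: equivclp_induct)
    case base
    then show ?case by (intro exI[of _ "\<lambda>_. 0"]) simp
  next
    case (step c d)
    obtain f :: "'a \<times> 'b \<Rightarrow> rat" where f: "\<And>e. e\<in>E \<Longrightarrow> (\<Sum>a\<in>{a\<in>E. fst a = fst e}. f a) = 0"
      "\<And>e. e\<in>E \<Longrightarrow> (\<Sum>a\<in>{a\<in>E. snd a = snd e}. f a) = of_bool (snd e = snd c) - of_bool (snd e0 = snd e)"
      using step.IH by blast
    have cE: "c \<in> E" using step E by simp
    have dE: "d \<in> E" using equivclp_into_equivclp[OF step.hyps] E by simp
    show ?case
    proof (cases "snd c = snd d")
      case True
      then show ?thesis using f by (intro exI[of _ f]) simp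
    next
      case False
      then have fst: "fst c = fst d" using step r by metis
      \<comment> \<open>The edges \<open>d\<close> and \<open>c\<close> meet at their first
        coordinate, where \<open>d - c\<close> contributes zero; at the second coordinates it moves
        the boundary from \<open>snd c\<close> to \<open>snd d\<close>.\<close>
      define g where "g a = f a + of_bool (a = d) - of_bool (a = c)" for a
      have sums: "(\<Sum>a\<in>{a\<in>E. P a}. g a) = (\<Sum>a\<in>{a\<in>E. P a}. f a) + of_bool (P d) - of_bool (P c)" for P
        using fin cE dE
        by (simp add: g_def sum.distrib sum_subtractf of_bool_def)
      show ?thesis
        using f fst by (intro exI[of _ g]) (auto simp: sums of_bool_def)
    qed
  qed
qed

text \<open>The combinatorial core, with \<open>g\<close>, \<open>h\<close>, \<open>k\<close> as
  coefficient functions of the three chains. The boundary of \<open>g\<close> will be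
  \<open>[fst e0] + U\<close> and that of \<open>h\<close> will be \<open>[snd e0] - U\<close>, so
  the remainder \<open>k\<close> has boundary zero.\<close>

lemma connected_decoupling:
  fixes r :: "'a \<times> 'b \<Rightarrow> 'a \<times> 'b \<Rightarrow> bool"
  assumes r: "\<And>a b. r a b \<Longrightarrow> fst a = fst b \<or> snd a = snd b"
    and E: "E = {a. equivclp r e0 a}" and fin: "finite E"
  shows "\<exists>g h k :: 'a \<times> 'b \<Rightarrow> rat.
    (\<forall>a\<in>E. of_bool (a = e0) = g a + h a + k a) \<and>
    (\<forall>p\<in>line_auts E (\<lambda>a. fst a = fst e0). \<forall>a\<in>E. g (p a) = g a) \<and>
    (\<forall>p\<in>line_auts E (\<lambda>a. snd a = snd e0). \<forall>a\<in>E. h (p a) = h a) \<and>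
    (\<forall>e\<in>E. (\<Sum>a\<in>{a\<in>E. fst a = fst e}. k a) = 0) \<and>
    (\<forall>e\<in>E. (\<Sum>a\<in>{a\<in>E. snd a = snd e}. k a) = 0)"
proof -
  define R where "R = snd ` E"
  have e0: "e0 \<in> E" by (simp add: E)
  have R: "finite R" "card R > 0" using fin e0 by (auto simp: R_def card_gt_0_iff)
  have "\<forall>v\<in>R. \<exists>f :: 'a \<times> 'b \<Rightarrow> rat. (\<forall>e\<in>E. (\<Sum>a\<in>{a\<in>E. fst a = fst e}. f a) = 0) \<and>
     (\<forall>e\<in>E. (\<Sum>a\<in>{a\<in>E. snd a = snd e}. f a) = of_bool (snd e = v) - of_bool (snd e0 = snd e))"
    unfolding R_def using connected_row_difference[OF r E fin] by auto
  from bchoice[OF this] obtain F :: "'b \<Rightarrow> 'a \<times> 'b \<Rightarrow> rat"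
    where F: "\<And>v e. v \<in> R \<Longrightarrow> e \<in> E \<Longrightarrow> (\<Sum>a\<in>{a\<in>E. fst a = fst e}. F v a) = 0"
      "\<And>v e. v \<in> R \<Longrightarrow> e \<in> E \<Longrightarrow> (\<Sum>a\<in>{a\<in>E. snd a = snd e}. F v a) = of_bool (snd e = v) - of_bool (snd e0 = snd e)"
    by fast
  \<comment> \<open>Averaging the path chains over all targets in \<open>R\<close> gives a chain
    with boundary \<open>U - [snd e0]\<close>, where \<open>U\<close> takes the value
    \<open>unif\<close> at every second coordinate.\<close>
  define \<rho> where "\<rho> a = (\<Sum>v\<in>R. F v a) / of_nat (card R)" for a
  define unif :: rat where "unif = 1 / of_nat (card R)"
  have \<rho>1: "(\<Sum>a\<in>{a\<in>E. fst a = fst e}. \<rho> a) = 0" if "e \<in> E" for e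
    unfolding \<rho>_def sum_divide_distrib[symmetric] by (subst sum.swap) (simp add: F that)
  have \<rho>2: "(\<Sum>a\<in>{a\<in>E. snd a = snd e}. \<rho> a) = unif - of_bool (snd e0 = snd e)" if "e \<in> E" for e
  proof -
    have "snd e \<in> R" using that by (simp add: R_def)
    then have "(\<Sum>v\<in>R. of_bool (snd e = v) - of_bool (snd e0 = snd e)) = 1 - of_nat (card R) * (of_bool (snd e0 = snd e) :: rat)"
      using R by (simp add: sum_subtractf of_bool_def)
    moreover have "(\<Sum>a\<in>{a\<in>E. snd a = snd e}. \<rho> a) = (\<Sum>v\<in>R. of_bool (snd e = v) - of_bool (snd e0 = snd e)) / of_nat (card R)"
      unfolding \<rho>_def sum_divide_distrib[symmetric] by (subst sum.swap) (simp add: F that)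
    ultimately have "(\<Sum>a\<in>{a\<in>E. snd a = snd e}. \<rho> a) =
        (1 - of_nat (card R) * of_bool (snd e0 = snd e)) / of_nat (card R)" by simp
    then show ?thesis using R by (auto simp: unif_def diff_divide_distrib)
  qed
  \<comment> \<open>Adding \<open>e0\<close> to \<open>\<rho>\<close> cancels the boundary at
    \<open>snd e0\<close> and leaves \<open>[fst e0] + U\<close>; the boundary of
    \<open>- \<rho>\<close> is \<open>[snd e0] - U\<close>. The averages then inherit these
    invariant boundaries.\<close>
  define g where "g = line_average E (\<lambda>a. fst a = fst e0) (\<lambda>a. of_bool (a = e0) + \<rho> a)"
  define h where "h = line_average E (\<lambda>a. snd a = snd e0) (\<lambda>a. - \<rho> a)"
  define k where "k a = of_bool (a = e0) - g a - h a" for a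
  have single: "(\<Sum>a\<in>{a\<in>E. P a}. of_bool (a = e0)) = (of_bool (P e0) :: rat)" for P
    using fin e0 by (simp add: of_bool_def)
  have auts: "fst (p a) = fst (p b) \<longleftrightarrow> fst a = fst b" "snd (p a) = snd (p b) \<longleftrightarrow> snd a = snd b"
    if "p \<in> line_auts E Q" "a \<in> E" "b \<in> E" for p a b Q
    using that unfolding line_auts_def by auto
  \<comment> \<open>Invariance of \<open>[fst e0]\<close> and \<open>[snd e0]\<close> under the
    respective stabilisers; the constant \<open>U\<close> is invariant under every line
    automorphism.\<close>
  have fix_auts: "p \<in> line_auts E (\<lambda>a. fst a = fst e0) \<Longrightarrow> a \<in> E \<Longrightarrow> fst e0 = fst (p a) \<longleftrightarrow> fst e0 = fst a"
    "p \<in> line_auts E (\<lambda>a. snd a = snd e0) \<Longrightarrow> a \<in> E \<Longrightarrow> snd e0 = snd (p a) \<longleftrightarrow> snd e0 = snd a" for p a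
    unfolding line_auts_def by (auto simp: eq_commute[of "fst e0"] eq_commute[of "snd e0"])
  have g1: "(\<Sum>a\<in>{a\<in>E. fst a = fst e}. g a) = of_bool (fst e0 = fst e)" if "e \<in> E" for e
    unfolding g_def
    by (rule line_average_line_sum[OF fin])
       (use that in \<open>auto simp: auts fix_auts sum.distrib single \<rho>1\<close>)
  have g2: "(\<Sum>a\<in>{a\<in>E. snd a = snd e}. g a) = unif" if "e \<in> E" for e
    unfolding g_def
    by (rule line_average_line_sum[OF fin])
       (use that in \<open>auto simp: auts fix_auts sum.distrib single \<rho>2\<close>)
  have h1: "(\<Sum>a\<in>{a\<in>E. fst a = fst e}. h a) = 0" if "e \<in> E" for e
    unfolding h_def
    by (rule line_average_line_sum[OF fin])
       (use that in \<open>auto simp: auts fix_auts sum_negf \<rho>1\<close>)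
  have h2: "(\<Sum>a\<in>{a\<in>E. snd a = snd e}. h a) = of_bool (snd e0 = snd e) - unif" if "e \<in> E" for e
    unfolding h_def
    by (rule line_average_line_sum[OF fin])
       (use that in \<open>auto simp: auts fix_auts sum_negf \<rho>2\<close>)
  show ?thesis
  proof (rule exI[of _ g], rule exI[of _ h], rule exI[of _ k], intro conjI ballI)
    show "of_bool (a = e0) = g a + h a + k a" for a by (simp add: k_def)
    show "(\<Sum>a\<in>{a\<in>E. fst a = fst e}. k a) = 0" if "e \<in> E" for e
      using that by (auto simp: k_def sum_subtractf single g1 h1)
    show "(\<Sum>a\<in>{a\<in>E. snd a = snd e}. k a) = 0" if "e \<in> E" for e
      using that by (auto simp: k_def sum_subtractf single g2 h2)
  qed (simp_all add: g_def h_def line_average_invariant[OF fin])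
qed

subsection \<open>Ring morphisms and algebraic independence\<close>

locale comm_ring_morphism =
  fixes h :: "'a::comm_ring_1 \<Rightarrow> 'b::comm_ring_1"
  assumes one: "h 1 = 1" and add: "h (a + b) = h a + h b" and mult: "h (a * b) = h a * h b"
begin

lemma zero: "h 0 = 0"
  using add[of 0 0] by simp

lemma sum: "h (\<Sum>i\<in>I. f i) = (\<Sum>i\<in>I. h (f i))"
  by (induction I rule: infinite_finite_induct) (simp_all add: zero add)

lemma power: "h (a ^ n) = h a ^ n"
  by (induction n) (simp_all add: one mult)

lemma eval_pCons: "poly (map_poly h (pCons a p)) z = h a + z * poly (map_poly h p) z"
  by (cases "pCons a p = 0") (simp_all add: map_poly_pCons zero)

lemma eval_monom: "poly (map_poly h (monom c n)) z = h c * z ^ n"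
  by (simp add: map_poly_monom zero poly_monom)

lemma eval_add: "poly (map_poly h (p + q)) z = poly (map_poly h p) z + poly (map_poly h q) z"
  by (induction p q rule: poly_induct2) (simp_all add: eval_pCons zero add algebra_simps)

lemma eval_smult: "poly (map_poly h (smult c p)) z = h c * poly (map_poly h p) z"
  by (induction p) (simp_all add: eval_pCons zero mult algebra_simps)

lemma eval_mult: "poly (map_poly h (p * q)) z = poly (map_poly h p) z * poly (map_poly h q) z"
  by (induction p) (simp_all add: eval_pCons eval_add eval_smult zero algebra_simps)

text \<open>Iterating this leads from \<open>\<iota>\<close> to evaluation in \<open>X\<close>, then
  to \<open>eval2\<close> and \<open>eval3\<close>, each evaluating its coefficients by the
  preceding morphism.\<close>

lemma comm_ring_morphism_eval: "comm_ring_morphism (\<lambda>p. poly (map_poly h p) z)"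
  by unfold_locales (simp_all add: eval_add eval_mult one)

lemma eval_sum: "poly (map_poly h p) z = (\<Sum>i\<le>degree p. h (poly.coeff p i) * z ^ i)"
proof -
  interpret ev: comm_ring_morphism "\<lambda>p. poly (map_poly h p) z"
    by (rule comm_ring_morphism_eval)
  have "poly (map_poly h p) z = poly (map_poly h (\<Sum>i\<le>degree p. monom (poly.coeff p i) i)) z"
    by (simp add: poly_as_sum_of_monoms)
  then show ?thesis by (simp only: ev.sum eval_monom)
qed

end

lemma field_embedding_morphism: "field_embedding \<iota> \<Longrightarrow> comm_ring_morphism \<iota>"
  unfolding field_embedding_def by unfold_locales auto

lemma eval1_morphism: "field_embedding \<iota> \<Longrightarrow> comm_ring_morphism (\<lambda>q. poly (map_poly \<iota> q) u)"
  by (rule comm_ring_morphism.comm_ring_morphism_eval[OF field_embedding_morphism])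

lemma eval2_morphism: "field_embedding \<iota> \<Longrightarrow> comm_ring_morphism (\<lambda>p. eval2 \<iota> p u v)"
  unfolding eval2_def by (rule comm_ring_morphism.comm_ring_morphism_eval[OF eval1_morphism])

lemma eval3_morphism: "field_embedding \<iota> \<Longrightarrow> comm_ring_morphism (\<lambda>p. eval3 \<iota> p u v t)"
  unfolding eval3_def by (rule comm_ring_morphism.comm_ring_morphism_eval[OF eval2_morphism])

lemma eval2_monom: "field_embedding \<iota> \<Longrightarrow> eval2 \<iota> (monom q j) u v = poly (map_poly \<iota> q) u * v ^ j"
  unfolding eval2_def by (rule comm_ring_morphism.eval_monom[OF eval1_morphism])

lemma eval2_monom_monom: "field_embedding \<iota> \<Longrightarrow> eval2 \<iota> (monom (monom c i) j) u v = \<iota> c * u ^ i * v ^ j"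
  by (simp add: eval2_monom comm_ring_morphism.eval_monom[OF field_embedding_morphism])

lemma eval2_sum:
  "field_embedding \<iota> \<Longrightarrow> eval2 \<iota> p u v = (\<Sum>j\<le>degree p. poly (map_poly \<iota> (poly.coeff p j)) u * v ^ j)"
  unfolding eval2_def by (rule comm_ring_morphism.eval_sum[OF eval1_morphism])

section \<open>Linear algebra over a domain and algebraic independence\<close>

text \<open>Gaussian elimination without division, by induction on the equations. A domain suffices,
  which allows polynomials in \<open>X\<close> as coefficients and as solutions.\<close>

lemma homogeneous_system_nontrivial_solution:
  fixes f :: "'i \<Rightarrow> 'j \<Rightarrow> 'a::idom"
  assumes "finite J" and "finite I" and "card J < card I"
  shows "\<exists>c. (\<exists>i\<in>I. c i \<noteq> 0) \<and> (\<forall>j\<in>J. (\<Sum>i\<in>I. c i * f i j) = 0)"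
  using assms
proof (induction J arbitrary: I f rule: finite_induct)
  case empty
  then have "I \<noteq> {}" by auto
  then show ?case by (intro exI[of _ "\<lambda>_. 1"]) auto
next
  case (insert j J)
  show ?case
  proof (cases "\<forall>i\<in>I. f i j = 0")
    case True
    then show ?thesis using insert.IH[OF insert.prems(1), of f] insert by auto
  next
    case False
    then obtain i0 where i0: "i0 \<in> I" "f i0 j \<noteq> 0" by blast
    define I' where "I' = I - {i0}"
    have I': "finite I'" "I = insert i0 I'" "i0 \<notin> I'" "card J < card I'"
      using i0 insert by (auto simp: I'_def)
    obtain c where c: "\<exists>i\<in>I'. c i \<noteq> 0"
      "\<And>k. k \<in> J \<Longrightarrow> (\<Sum>i\<in>I'. c i * (f i0 j * f i k - f i j * f i0 k)) = 0"
      using insert.IH[OF I'(1,4), of "\<lambda>i k. f i0 j * f i k - f i j * f i0 k"] by blast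
    \<comment> \<open>The solution of the reduced system is scaled by the pivot
      \<open>f i0 j\<close>, and the value at \<open>i0\<close> is chosen so that equation
      \<open>j\<close> holds.\<close>
    define d where "d i = (if i = i0 then - (\<Sum>i\<in>I'. c i * f i j) else c i * f i0 j)" for i
    have d: "(\<Sum>i\<in>I. d i * f i k) = (\<Sum>i\<in>I'. c i * (f i0 j * f i k - f i j * f i0 k))" for k
    proof -
      have "(\<Sum>i\<in>I'. d i * f i k) = (\<Sum>i\<in>I'. c i * f i0 j * f i k)"
        using I' by (intro sum.cong) (auto simp: d_def)
      then show ?thesis
        using I' by (simp add: d_def sum_distrib_left sum_subtractf algebra_simps)
    qed
    have "(\<Sum>i\<in>I. d i * f i k) = 0" if "k \<in> insert j J" for k
      using that c(2) unfolding d by (cases "k = j") (simp_all add: algebra_simps)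
    moreover have "\<exists>i\<in>I. d i \<noteq> 0" using c(1) i0 I' by (auto simp: d_def)
    ultimately show ?thesis by blast
  qed
qed

lemma alg_independent2_eqD: "alg_independent2 \<iota> u v \<Longrightarrow> eval2 \<iota> p u v = 0 \<Longrightarrow> p = 0"
  unfolding alg_independent2_def by blast

text \<open>Multiplying a relation \<open>q(u,s) = 0\<close> of degree \<open>n\<close> by the
  \<open>n\<close>-th power of \<open>B\<close> turns it into a relation between \<open>u\<close>
  and \<open>v\<close>. That relation is nontrivial, since only its term \<open>T n\<close> reaches
  \<open>Y\<close>-degree \<open>n * degree A\<close>.\<close>

lemma alg_independent2_ratio:
  assumes \<iota>: "field_embedding \<iota>" and ind: "alg_independent2 \<iota> u v"
    and s: "eval2 \<iota> A u v = s * eval2 \<iota> B u v" and deg: "degree B < degree A"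
  shows "alg_independent2 \<iota> u s"
  unfolding alg_independent2_def
proof (intro allI impI notI)
  fix q :: "complex poly poly" assume q: "q \<noteq> 0" and q0: "eval2 \<iota> q u s = 0"
  interpret ev: comm_ring_morphism "\<lambda>p. eval2 \<iota> p u v" by (rule eval2_morphism[OF \<iota>])
  define n where "n = degree q"
  define T where "T i = [:poly.coeff q i:] * A ^ i * B ^ (n - i)" for i
  have const: "eval2 \<iota> [:c:] u v = poly (map_poly \<iota> c) u" for c
    using eval2_monom[OF \<iota>, of c 0 u v] by (simp add: monom_0)
  have "eval2 \<iota> (\<Sum>i\<le>n. T i) u v = (\<Sum>i\<le>n. eval2 \<iota> B u v ^ n * (poly (map_poly \<iota> (poly.coeff q i)) u * s ^ i))"
    unfolding T_def ev.sum
  proof (rule sum.cong)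
    fix i assume "i \<in> {..n}"
    then have "eval2 \<iota> B u v ^ n = eval2 \<iota> B u v ^ i * eval2 \<iota> B u v ^ (n - i)"
      by (simp flip: power_add)
    then show "eval2 \<iota> ([:poly.coeff q i:] * A ^ i * B ^ (n - i)) u v =
         eval2 \<iota> B u v ^ n * (poly (map_poly \<iota> (poly.coeff q i)) u * s ^ i)"
      by (simp only: ev.mult ev.power const s power_mult_distrib mult_ac)
  qed simp
  also have "\<dots> = 0"
    using q0 eval2_sum[OF \<iota>, of q u s] by (simp add: n_def flip: sum_distrib_left)
  finally have "(\<Sum>i\<le>n. T i) = 0" by (rule alg_independent2_eqD[OF ind])
  moreover have "poly.coeff (\<Sum>i\<le>n. T i) (n * degree A) \<noteq> 0"
  proof -
    have "poly.coeff (T i) (n * degree A) = 0" if "i < n" for i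
    proof (rule coeff_eq_0)
      have "degree (T i) \<le> i * degree A + (n - i) * degree B"
        unfolding T_def
        using degree_mult_le[of "[:poly.coeff q i:] * A ^ i" "B ^ (n - i)"]
          degree_mult_le[of "[:poly.coeff q i:]" "A ^ i"] degree_power_le[of A i] degree_power_le[of B "n - i"]
        by (simp add: mult.commute)
      also have "\<dots> < i * degree A + (n - i) * degree A" using that deg by simp
      also have "\<dots> = n * degree A" using that by (simp flip: add_mult_distrib)
      finally show "degree (T i) < n * degree A" .
    qed
    then have "poly.coeff (\<Sum>i\<le>n. T i) (n * degree A) = poly.coeff (T n) (n * degree A)"
      by (simp add: coeff_sum lessThan_Suc_atMost[symmetric])
    also have "\<dots> = lead_coeff q * lead_coeff A ^ n"
      using deg lead_coeff_power[of A n] degree_power_eq[of A n] by (force simp: T_def n_def)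
    finally show ?thesis using q deg by auto
  qed
  ultimately show False by simp
qed

text \<open>Elimination by a dimension count. Given \<open>p(u,v) = 0\<close>, the products
  \<open>A ^ i * B ^ (d - i)\<close> and the multiples of \<open>p\<close> by powers of
  \<open>Y\<close> are too many to be linearly independent over polynomials in \<open>X\<close>. At
  \<open>(u,v)\<close> the multiples of \<open>p\<close> vanish, and the rest of the dependence is a
  relation between \<open>u\<close> and \<open>s\<close>.\<close>

lemma alg_independent2_of_ratio:
  assumes \<iota>: "field_embedding \<iota>" and ind: "alg_independent2 \<iota> u s"
    and s: "eval2 \<iota> A u v = s * eval2 \<iota> B u v" and B: "eval2 \<iota> B u v \<noteq> 0"
  shows "alg_independent2 \<iota> u v"
  unfolding alg_independent2_def
proof (intro allI impI notI)
  fix p :: "complex poly poly" assume p: "p \<noteq> 0" and p0: "eval2 \<iota> p u v = 0"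
  interpret ev: comm_ring_morphism "\<lambda>p. eval2 \<iota> p u v" by (rule eval2_morphism[OF \<iota>])
  interpret evs: comm_ring_morphism "\<lambda>p. eval2 \<iota> p u s" by (rule eval2_morphism[OF \<iota>])
  define d where "d = degree p"
  \<comment> \<open>This bounds the degree of every product \<open>A ^ i * B ^ (d - i)\<close>. The
    family \<open>G\<close> has \<open>d + e + 2\<close> members of degree at most
    \<open>d + e\<close>, one more than the number of coefficients.\<close>
  define e where "e = d * (degree A + degree B)"
  define G where "G = case_sum (\<lambda>i. A ^ i * B ^ (d - i)) (\<lambda>k. monom 1 k * p)"
  define I where "I = {..d} <+> {..e}"
  have deg: "degree (G i) \<le> d + e" if "i \<in> I" for i
  proof (cases i)
    case (Inl i')
    then have i': "i' \<le> d" using that by (auto simp: I_def)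
    have "degree (G i) \<le> i' * degree A + (d - i') * degree B"
      using degree_mult_le[of "A ^ i'" "B ^ (d - i')"] degree_power_le[of A i'] degree_power_le[of B "d - i'"]
      by (simp add: G_def Inl mult.commute)
    also have "\<dots> \<le> e" unfolding e_def distrib_left using i' by (intro add_mono mult_right_mono) auto
    finally show ?thesis by simp
  next
    case (Inr k)
    then have "degree (G i) \<le> k + d"
      using degree_mult_le[of "monom 1 k" p] by (simp add: G_def d_def degree_monom_eq)
    then show ?thesis using Inr that by (auto simp: I_def)
  qed
  have "card {..d + e} < card I" "finite I" by (simp_all add: I_def card_Plus)
  then obtain c where c: "\<exists>i\<in>I. c i \<noteq> 0" "\<And>j. j \<le> d + e \<Longrightarrow> (\<Sum>i\<in>I. c i * poly.coeff (G i) j) = 0"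
    using homogeneous_system_nontrivial_solution[of "{..d+e}" I "\<lambda>i. poly.coeff (G i)"] by auto
  have "(\<Sum>i\<in>I. smult (c i) (G i)) = 0"
  proof (rule poly_eqI)
    fix j show "poly.coeff (\<Sum>i\<in>I. smult (c i) (G i)) j = poly.coeff 0 j"
    proof (cases "j \<le> d + e")
      case False
      then have "poly.coeff (G i) j = 0" if "i \<in> I" for i using deg[OF that] by (intro coeff_eq_0) simp
      then show ?thesis by (simp add: coeff_sum)
    qed (simp add: coeff_sum c)
  qed
  then have rel: "(\<Sum>i\<le>d. smult (c (Inl i)) (A ^ i * B ^ (d - i))) + (\<Sum>k\<le>e. monom (c (Inr k)) k) * p = 0"
  proof -
    have "smult a (monom 1 k * p) = monom a k * p" for a k
      by (metis mult.right_neutral mult_smult_left smult_monom)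
    then have "(\<Sum>k\<le>e. smult (c (Inr k)) (monom 1 k * p)) = (\<Sum>k\<le>e. monom (c (Inr k)) k) * p"
      by (simp only: sum_distrib_right)
    moreover have "(\<Sum>i\<in>I. smult (c i) (G i)) = (\<Sum>i\<le>d. smult (c (Inl i)) (A ^ i * B ^ (d - i)))
        + (\<Sum>k\<le>e. smult (c (Inr k)) (monom 1 k * p))"
      unfolding I_def by (simp add: sum.Plus G_def comp_def del: smult_monom mult_smult_left)
    ultimately show ?thesis using \<open>(\<Sum>i\<in>I. smult (c i) (G i)) = 0\<close> by argo
  qed
  define q where "q = (\<Sum>i\<le>d. monom (c (Inl i)) i)"
  have coeff_q: "poly.coeff q i = c (Inl i)" if "i \<le> d" for i
    using that by (simp add: q_def coeff_sum)
  \<comment> \<open>If \<open>q\<close> vanished, the dependence would be a polynomial times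
    \<open>p\<close> equal to zero; as \<open>p\<close> is nonzero, all its coefficients would be
    zero.\<close>
  have "q \<noteq> 0"
  proof
    assume "q = 0"
    then have Inl: "c (Inl i) = 0" if "i \<le> d" for i using coeff_q[OF that] by simp
    then have "(\<Sum>k\<le>e. monom (c (Inr k)) k) = 0" using rel p by simp
    then have "poly.coeff (\<Sum>k\<le>e. monom (c (Inr k)) k) k = 0" for k by simp
    then have "(if k \<le> e then c (Inr k) else 0) = 0" for k
      by (simp add: coeff_sum)
    then have "c (Inr k) = 0" if "k \<le> e" for k
      using that by presburger
    then show False using Inl c(1) by (auto simp: I_def)
  qed
  moreover have "eval2 \<iota> q u s = 0"
  proof -
    have sm: "eval2 \<iota> (smult a P) u v = poly (map_poly \<iota> a) u * eval2 \<iota> P u v" for a P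
      using ev.mult[of "[:a:]" P] eval2_monom[OF \<iota>, of a 0 u v] by (simp add: monom_0)
    have "0 = eval2 \<iota> (\<Sum>i\<le>d. smult (c (Inl i)) (A ^ i * B ^ (d - i))) u v"
      using arg_cong[OF rel, of "\<lambda>p. eval2 \<iota> p u v"] p0 by (simp add: ev.add ev.mult ev.zero)
    also have "\<dots> = (\<Sum>i\<le>d. eval2 \<iota> B u v ^ d * (poly (map_poly \<iota> (c (Inl i))) u * s ^ i))"
      unfolding ev.sum
    proof (rule sum.cong)
      fix i assume "i \<in> {..d}"
      then have "eval2 \<iota> B u v ^ d = eval2 \<iota> B u v ^ i * eval2 \<iota> B u v ^ (d - i)"
        by (simp flip: power_add)
      then show "eval2 \<iota> (smult (c (Inl i)) (A ^ i * B ^ (d - i))) u v =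
          eval2 \<iota> B u v ^ d * (poly (map_poly \<iota> (c (Inl i))) u * s ^ i)"
        by (simp only: sm ev.mult ev.power s power_mult_distrib mult_ac)
    qed simp
    also have "\<dots> = eval2 \<iota> B u v ^ d * eval2 \<iota> q u s"
      by (simp add: q_def evs.sum eval2_monom[OF \<iota>] sum_distrib_left)
    finally show ?thesis using B by simp
  qed
  ultimately show False using alg_independent2_eqD[OF ind] by blast
qed

text \<open>Needed because fractions are evaluated at \<open>t = 1/S(x,y)\<close>. The value
  \<open>s\<close> is the ratio \<open>1/Y\<close> at \<open>Y = 1/s\<close>, so elimination
  applies.\<close>

lemma alg_independent2_inverse:
  assumes \<iota>: "field_embedding \<iota>" and ind: "alg_independent2 \<iota> u s"
  shows "alg_independent2 \<iota> u (1 / s)"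
proof (rule alg_independent2_of_ratio[OF \<iota> ind, where A = 1 and B = "monom 1 1"])
  interpret ev: comm_ring_morphism "\<lambda>p. eval2 \<iota> p u (1 / s)" by (rule eval2_morphism[OF \<iota>])
  interpret e1: comm_ring_morphism "\<lambda>p. poly (map_poly \<iota> p) u" by (rule eval1_morphism[OF \<iota>])
  have "eval2 \<iota> (monom 1 1) u s = s" by (simp add: eval2_monom[OF \<iota>] e1.one)
  then have "s \<noteq> 0" using ind unfolding alg_independent2_def by (metis monom_eq_0_iff one_neq_zero)
  then show "eval2 \<iota> 1 u (1 / s) = s * eval2 \<iota> (monom 1 1) u (1 / s)" 
    "eval2 \<iota> (monom 1 1) u (1 / s) \<noteq> 0"
    by (simp_all add: eval2_monom[OF \<iota>] e1.one ev.one)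
qed

text \<open>Nested polynomials treat the two variables differently, so exchanging them means
  transposing the array of coefficients.\<close>

lemma alg_independent2_sym:
  assumes \<iota>: "field_embedding \<iota>" and ind: "alg_independent2 \<iota> u v"
  shows "alg_independent2 \<iota> v u"
  unfolding alg_independent2_def
proof (intro allI impI notI)
  fix p :: "complex poly poly" assume p: "p \<noteq> 0" and p0: "eval2 \<iota> p v u = 0"
  interpret e1: comm_ring_morphism "\<lambda>p. poly (map_poly \<iota> p) w" for w by (rule eval1_morphism[OF \<iota>])
  interpret uv: comm_ring_morphism "\<lambda>p. eval2 \<iota> p u v" by (rule eval2_morphism[OF \<iota>])
  note monom = comm_ring_morphism.eval_monom[OF field_embedding_morphism[OF \<iota>]]
  \<comment> \<open>A common bound for the inner degrees makes the array a finite rectangle, which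
    can be summed in either order.\<close>
  define d where "d = Max ((\<lambda>j. degree (poly.coeff p j)) ` {..degree p})"
  define q where "q = (\<Sum>i\<le>d. monom (\<Sum>j\<le>degree p. monom (poly.coeff (poly.coeff p j) i) j) i)"
  have d: "degree (poly.coeff p j) \<le> d" if "j \<le> degree p" for j
    using that by (simp add: d_def)
  have pj: "poly (map_poly \<iota> (poly.coeff p j)) v = (\<Sum>i\<le>d. \<iota> (poly.coeff (poly.coeff p j) i) * v ^ i)"
    if "j \<le> degree p" for j
  proof -
    have "poly (map_poly \<iota> (poly.coeff p j)) v =
        poly (map_poly \<iota> (\<Sum>i\<le>d. monom (poly.coeff (poly.coeff p j) i) i)) v"
      by (simp only: poly_as_sum_of_monoms'[OF d[OF that]])
    then show ?thesis by (simp only: e1.sum monom)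
  qed
  have "eval2 \<iota> q u v = (\<Sum>i\<le>d. \<Sum>j\<le>degree p. \<iota> (poly.coeff (poly.coeff p j) i) * v ^ i * u ^ j)"
    by (simp add: q_def uv.sum eval2_monom[OF \<iota>] e1.sum monom sum_distrib_left mult_ac)
  also have "\<dots> = eval2 \<iota> p v u"
    by (subst sum.swap) (simp add: eval2_sum[OF \<iota>, of p] pj sum_distrib_right)
  finally have "q = 0" using p0 alg_independent2_eqD[OF ind] by simp
  have "poly.coeff (poly.coeff p j) i = 0" for i j
  proof (cases "j \<le> degree p \<and> i \<le> d")
    case True
    then have "poly.coeff (poly.coeff q i) j = poly.coeff (poly.coeff p j) i"
      by (simp add: q_def coeff_sum)
    then show ?thesis by (simp add: \<open>q = 0\<close>)
  next
    case False
    then show ?thesis using d[of j] by (cases "j \<le> degree p") (auto simp: coeff_eq_0)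
  qed
  then show False using p by (simp add: poly_eq_iff)
qed

subsection \<open>Algebraic independence along the orbit\<close>

lemma step_poly_swap:
  "step_poly \<iota> (prod.swap ` \<S>) (w \<circ> prod.swap) v u = step_poly \<iota> \<S> w u v"
  unfolding step_poly_def
  by (subst sum.reindex) (auto simp: case_prod_beta mult_ac intro!: sum.cong)

lemma m_swap: "m_x (prod.swap ` \<S>) = m_y \<S>" "m_y (prod.swap ` \<S>) = m_x \<S>" "M_y (prod.swap ` \<S>) = M_x \<S>"
  by (simp_all add: m_x_def m_y_def M_x_def M_y_def image_image)

section \<open>The step polynomial as a quotient of polynomials\<close>

text \<open>This is \<open>S\<close> times the monomial \<open>step_denom\<close> that clears its
  negative exponents; the kernel polynomial is \<open>step_denom\<close> minus \<open>t\<close>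
  times this one.\<close>

definition step_numer :: "(int \<times> int) set \<Rightarrow> (int \<times> int \<Rightarrow> complex) \<Rightarrow> complex poly poly" where
  "step_numer \<S> w = (\<Sum>(i, j)\<in>\<S>. monom (monom (w (i, j)) (nat (i + m_x \<S>))) (nat (j + m_y \<S>)))"

definition step_denom :: "(int \<times> int) set \<Rightarrow> complex poly poly" where
  "step_denom \<S> = monom (monom 1 (nat (m_x \<S>))) (nat (m_y \<S>))"

lemma step_bounds:
  assumes "finite \<S>" and "(i, j) \<in> \<S>"
  shows "0 \<le> i + m_x \<S>" and "0 \<le> j + m_y \<S>"
proof -
  have "Min (fst ` \<S>) \<le> i" "Min (snd ` \<S>) \<le> j" using assms by (force intro!: Min_le)+
  then show "0 \<le> i + m_x \<S>" and "0 \<le> j + m_y \<S>" by (simp_all add: m_x_def m_y_def)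
qed

lemma eval2_step_denom:
  "field_embedding \<iota> \<Longrightarrow> eval2 \<iota> (step_denom \<S>) u v = u ^ nat (m_x \<S>) * v ^ nat (m_y \<S>)"
  by (simp add: step_denom_def eval2_monom_monom comm_ring_morphism.one[OF field_embedding_morphism])

lemma eval2_step_numer:
  assumes \<iota>: "field_embedding \<iota>" and fin: "finite \<S>" and m: "m_x \<S> \<ge> 0" "m_y \<S> \<ge> 0"
    and nz: "u \<noteq> 0" "v \<noteq> 0"
  shows "eval2 \<iota> (step_numer \<S> w) u v = step_poly \<iota> \<S> w u v * eval2 \<iota> (step_denom \<S>) u v"
proof -
  interpret ev: comm_ring_morphism "\<lambda>p. eval2 \<iota> p u v" by (rule eval2_morphism[OF \<iota>])
  have pow: "z powi i * z ^ nat m = z ^ nat (i + m)" if "z \<noteq> 0" "m \<ge> 0" "0 \<le> i + m" for z :: 'a and i m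
    using that by (simp add: power_int_add flip: power_int_of_nat)
  have "eval2 \<iota> (step_numer \<S> w) u v
      = (\<Sum>(i, j)\<in>\<S>. \<iota> (w (i, j)) * u ^ nat (i + m_x \<S>) * v ^ nat (j + m_y \<S>))"
    by (simp add: step_numer_def ev.sum case_prod_beta eval2_monom_monom[OF \<iota>])
  also have "\<dots> = (\<Sum>(i, j)\<in>\<S>. \<iota> (w (i, j)) * u powi i * v powi j * (u ^ nat (m_x \<S>) * v ^ nat (m_y \<S>)))"
    using step_bounds[OF fin] m nz by (intro sum.cong) (auto simp flip: pow)
  finally show ?thesis
    by (simp add: step_poly_def eval2_step_denom[OF \<iota>] sum_distrib_right case_prod_beta)
qed

lemma degree_step_denom: "degree (step_denom \<S>) = nat (m_y \<S>)"
  by (simp add: step_denom_def degree_monom_eq)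

text \<open>Distinct steps give distinct monomials, so nothing cancels the monomial of a step with
  the largest \<open>Y\<close>-exponent.\<close>

lemma degree_step_numer:
  assumes fin: "finite \<S>" "\<S> \<noteq> {}" and w: "\<And>s. s \<in> \<S> \<Longrightarrow> w s \<noteq> 0" 
  shows "degree (step_numer \<S> w) \<ge> nat (M_y \<S> + m_y \<S>)"
proof (rule le_degree)
  have "M_y \<S> \<in> snd ` \<S>" using fin by (simp add: M_y_def)
  then obtain i where i: "(i, M_y \<S>) \<in> \<S>" by force
  \<comment> \<open>The shifted exponents are nonnegative, hence \<open>nat\<close> does not
    identify different steps.\<close>
  have "poly.coeff (poly.coeff (monom (monom (w s) (nat (fst s + m_x \<S>))) (nat (snd s + m_y \<S>)))
      (nat (M_y \<S> + m_y \<S>))) (nat (i + m_x \<S>)) = (if s = (i, M_y \<S>) then w s else 0)" if "s \<in> \<S>" for s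
    using step_bounds[OF fin(1), of "fst s" "snd s"] that step_bounds[OF fin(1) i]
    by (cases s) (auto simp: nat_eq_iff)
  then have "poly.coeff (poly.coeff (step_numer \<S> w) (nat (M_y \<S> + m_y \<S>))) (nat (i + m_x \<S>))
      = (\<Sum>s\<in>\<S>. if s = (i, M_y \<S>) then w s else 0)"
    unfolding step_numer_def coeff_sum case_prod_beta by (intro sum.cong) auto
  also have "\<dots> = w (i, M_y \<S>)" using fin i by simp
  finally show "poly.coeff (step_numer \<S> w) (nat (M_y \<S> + m_y \<S>)) \<noteq> 0" using w[OF i] by auto
qed

text \<open>Both ratio lemmas apply to the quotient form of \<open>S\<close>: its denominator is
  nonzero at \<open>(u,v)\<close>, and \<open>M_y \<S> > 0\<close> makes the \<open>Y\<close>-degree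
  of the numerator the larger one.\<close>

lemma alg_independent2_step_poly:
  assumes \<iota>: "field_embedding \<iota>" and fin: "finite \<S>" "\<S> \<noteq> {}" and w: "\<And>s. s \<in> \<S> \<Longrightarrow> w s \<noteq> 0"
    and m: "m_x \<S> \<ge> 0" "m_y \<S> \<ge> 0" "M_y \<S> > 0" and nz: "u \<noteq> 0" "v \<noteq> 0"
  shows "alg_independent2 \<iota> u (step_poly \<iota> \<S> w u v) \<longleftrightarrow> alg_independent2 \<iota> u v"
proof
  note eq = eval2_step_numer[OF \<iota> fin(1) m(1,2) nz, of w]
  show "alg_independent2 \<iota> u v" if "alg_independent2 \<iota> u (step_poly \<iota> \<S> w u v)"
    by (rule alg_independent2_of_ratio[OF \<iota> that eq]) (simp add: eval2_step_denom[OF \<iota>] nz)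
  have "degree (step_denom \<S>) < degree (step_numer \<S> w)"
    using degree_step_numer[OF fin, of w] w m by (simp add: degree_step_denom)
  then show "alg_independent2 \<iota> u (step_poly \<iota> \<S> w u v)" if "alg_independent2 \<iota> u v"
    using alg_independent2_ratio[OF \<iota> that eq] by blast
qed

text \<open>Obtained by exchanging the coordinates of the steps and of the pair.\<close>

lemma alg_independent2_step_poly':
  assumes \<iota>: "field_embedding \<iota>" and fin: "finite \<S>" "\<S> \<noteq> {}" and w: "\<And>s. s \<in> \<S> \<Longrightarrow> w s \<noteq> 0"
    and m: "m_x \<S> \<ge> 0" "m_y \<S> \<ge> 0" "M_x \<S> > 0" and nz: "u \<noteq> 0" "v \<noteq> 0"
  shows "alg_independent2 \<iota> v (step_poly \<iota> \<S> w u v) \<longleftrightarrow> alg_independent2 \<iota> u v"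
proof -
  have "alg_independent2 \<iota> v (step_poly \<iota> (prod.swap ` \<S>) (w \<circ> prod.swap) v u) \<longleftrightarrow> alg_independent2 \<iota> v u"
    by (rule alg_independent2_step_poly[OF \<iota>]) (use fin w m nz in \<open>auto simp: m_swap\<close>)
  then show ?thesis unfolding step_poly_swap using alg_independent2_sym[OF \<iota>] by blast
qed

lemma alg_independent2_nonzero:
  assumes \<iota>: "field_embedding \<iota>" and ind: "alg_independent2 \<iota> u v"
  shows "u \<noteq> 0" and "v \<noteq> 0"
proof -
  have "v \<noteq> 0" if "alg_independent2 \<iota> u v" for u v
    using alg_independent2_eqD[OF that, of "monom 1 1"] by (auto simp: eval2_monom[OF \<iota>])
  then show "u \<noteq> 0" and "v \<noteq> 0" using ind alg_independent2_sym[OF \<iota> ind] by blast+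
qed

text \<open>Related pairs share a coordinate and the value of \<open>S\<close>, and the independence
  of each is equivalent to that of these two shared elements.\<close>

lemma orbit_independent:
  assumes \<iota>: "field_embedding \<iota>" and fin: "finite \<S>" "\<S> \<noteq> {}" and w: "\<And>s. s \<in> \<S> \<Longrightarrow> w s \<noteq> 0"
    and m: "m_x \<S> > 0" "m_y \<S> > 0" "M_x \<S> > 0" "M_y \<S> > 0"
    and ind: "alg_independent2 \<iota> x y"
    and a: "a \<in> orbit \<iota> \<S> w x y"
  shows "alg_independent2 \<iota> (fst a) (snd a) \<and> step_poly \<iota> \<S> w (fst a) (snd a) = step_poly \<iota> \<S> w x y"
proof -
  have "equivclp (\<lambda>b c. sim_x \<iota> \<S> w b c \<or> sim_y \<iota> \<S> w b c) (x, y) a"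
    using a by (simp add: orbit_def)
  then show ?thesis
  proof (induction rule: equivclp_induct)
    case base
    then show ?case using ind by simp
  next
    case (step b c)
    obtain u v u' v' where bc: "b = (u, v)" "c = (u', v')" by fastforce
    have nz: "u \<noteq> 0" "v \<noteq> 0" "u' \<noteq> 0" "v' \<noteq> 0"
      and eq: "step_poly \<iota> \<S> w u v = step_poly \<iota> \<S> w u' v'" and share: "u = u' \<or> v = v'"
      using step(2) by (auto simp: bc sim_x_def sim_y_def)
    have iff: "alg_independent2 \<iota> u (step_poly \<iota> \<S> w u v) \<longleftrightarrow> alg_independent2 \<iota> u v"
      "alg_independent2 \<iota> v (step_poly \<iota> \<S> w u v) \<longleftrightarrow> alg_independent2 \<iota> u v"
      if "u \<noteq> 0" "v \<noteq> 0" for u v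
      using that m alg_independent2_step_poly[OF \<iota> fin w, where u = u and v = v]
        alg_independent2_step_poly'[OF \<iota> fin w, where u = u and v = v] by auto
    show ?case
      using step.IH iff[OF nz(1,2)] iff[OF nz(3,4)] eq share by (auto simp: bc)
  qed
qed

subsection \<open>Evaluation of decoupled fractions\<close>

text \<open>Dropping the absent variable \<open>Y\<close> leaves a polynomial in \<open>X\<close>
  and \<open>t\<close>. Keeping track of its being nonzero ensures that denominators do not vanish
  at independent pairs.\<close>

lemma eval3_Xt:
  assumes \<iota>: "field_embedding \<iota>" and Q: "Q \<in> polys_Xt"
  shows "\<exists>q. (\<forall>u v t. eval3 \<iota> Q u v t = eval2 \<iota> q u t) \<and> (Q \<noteq> 0 \<longrightarrow> q \<noteq> 0)"
proof -
  define q where "q = map_poly (\<lambda>c. poly.coeff c 0) Q"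
  have c: "poly.coeff Q n = [:poly.coeff q n:]" for n
    unfolding q_def using Q degree0_coeffs[of "poly.coeff Q n"] by (auto simp: polys_Xt_def coeff_map_poly)
  have "Q = 0" if "q = 0" using that c by (intro poly_eqI) simp
  moreover have "eval3 \<iota> Q u v t = eval2 \<iota> q u t" for u v t
  proof -
    interpret e2: comm_ring_morphism "\<lambda>p. eval2 \<iota> p u v" by (rule eval2_morphism[OF \<iota>])
    interpret e1: comm_ring_morphism "\<lambda>p. poly (map_poly \<iota> p) u" by (rule eval1_morphism[OF \<iota>])
    have "map_poly (\<lambda>p. eval2 \<iota> p u v) Q = map_poly (\<lambda>p. poly (map_poly \<iota> p) u) q"
      using eval2_monom[OF \<iota>, of _ 0 u v]
      by (intro poly_eqI) (simp add: coeff_map_poly e2.zero e1.zero c monom_0)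
    then show ?thesis unfolding eval3_def eval2_def[of _ q] by simp
  qed
  ultimately show ?thesis by blast
qed

lemma eval3_Yt:
  assumes \<iota>: "field_embedding \<iota>" and Q: "Q \<in> polys_Yt"
  shows "\<exists>q. (\<forall>u v t. eval3 \<iota> Q u v t = eval2 \<iota> q v t) \<and> (Q \<noteq> 0 \<longrightarrow> q \<noteq> 0)"
proof -
  define q where "q = map_poly (map_poly (\<lambda>c. poly.coeff c 0)) Q"
  have q: "poly.coeff (poly.coeff q n) m = poly.coeff (poly.coeff (poly.coeff Q n) m) 0" for n m
    by (simp add: q_def coeff_map_poly)
  have c: "poly.coeff (poly.coeff Q n) m = [:poly.coeff (poly.coeff q n) m:]" for n m
    unfolding q using Q degree0_coeffs[of "poly.coeff (poly.coeff Q n) m"] by (auto simp: polys_Yt_def)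
  have "Q = 0" if "q = 0" using that c by (intro poly_eqI) simp
  moreover have "eval3 \<iota> Q u v t = eval2 \<iota> q v t" for u v t
  proof -
    interpret e2: comm_ring_morphism "\<lambda>p. eval2 \<iota> p u v" by (rule eval2_morphism[OF \<iota>])
    interpret e1: comm_ring_morphism "\<lambda>p. poly (map_poly \<iota> p) z" for z by (rule eval1_morphism[OF \<iota>])
    interpret e0: comm_ring_morphism \<iota> by (rule field_embedding_morphism[OF \<iota>])
    have "map_poly (\<lambda>p. poly (map_poly \<iota> p) u) (poly.coeff Q n) = map_poly \<iota> (poly.coeff q n)" for n
      by (intro poly_eqI) (simp add: coeff_map_poly e0.zero c e0.eval_pCons)
    then have "map_poly (\<lambda>p. eval2 \<iota> p u v) Q = map_poly (\<lambda>p. poly (map_poly \<iota> p) v) q"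
      by (intro poly_eqI) (simp add: coeff_map_poly e2.zero e1.zero, simp add: eval2_def)
    then show ?thesis unfolding eval3_def eval2_def[of _ q] by simp
  qed
  ultimately show ?thesis by blast
qed

text \<open>The reduced denominator \<open>B\<close> divides \<open>Q * T\<close>, which is nonzero
  when \<open>u\<close> and \<open>v\<close> are each independent of \<open>t\<close>. Hence the
  reduced fraction has the same value there as the given decoupled expression.\<close>

lemma eval_decoupled:
  fixes \<iota> :: "complex \<Rightarrow> 'k::field"
  assumes \<iota>: "field_embedding \<iota>" and H: "H \<in> decoupled_fracs"
  shows "\<exists>f g :: 'k \<Rightarrow> 'k. \<forall>u v. alg_independent2 \<iota> u t \<longrightarrow> alg_independent2 \<iota> v t \<longrightarrow>
       eval3 \<iota> (fst (quot_of_fract H)) u v t / eval3 \<iota> (snd (quot_of_fract H)) u v t = f u + g v"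
proof -
  obtain P Q R T where PQ: "P \<in> polys_Xt" "Q \<in> polys_Xt" "Q \<noteq> 0" and RT: "R \<in> polys_Yt" "T \<in> polys_Yt" "T \<noteq> 0"
    and HE: "H = Fract P Q + Fract R T"
    using H unfolding decoupled_fracs_def fracs_def by blast
  obtain p where p: "\<And>u v t. eval3 \<iota> P u v t = eval2 \<iota> p u t"
    using eval3_Xt[OF \<iota> PQ(1)] by auto
  obtain q where q: "\<And>u v t. eval3 \<iota> Q u v t = eval2 \<iota> q u t" and q': "q \<noteq> 0"
    using eval3_Xt[OF \<iota> PQ(2)] PQ(3) by auto
  obtain r where r: "\<And>u v t. eval3 \<iota> R u v t = eval2 \<iota> r v t"
    using eval3_Yt[OF \<iota> RT(1)] by auto
  obtain s where s: "\<And>u v t. eval3 \<iota> T u v t = eval2 \<iota> s v t" and s': "s \<noteq> 0"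
    using eval3_Yt[OF \<iota> RT(2)] RT(3) by auto
  obtain A B where AB: "quot_of_fract H = (A, B)" by fastforce
  have B: "B \<noteq> 0" using snd_quot_of_fract_nonzero[of H] AB by simp
  have "Fract A B = H" using Fract_quot_of_fract[of H] AB by simp
  also have "\<dots> = Fract (P * T + R * Q) (Q * T)" unfolding HE using PQ RT by simp
  finally have eq: "A * (Q * T) = (P * T + R * Q) * B" using B PQ RT by (simp add: eq_fract)
  have "coprime A B" using coprime_quot_of_fract[of H] AB by simp
  then have "B dvd Q * T"
    using eq by (metis coprime_commute coprime_dvd_mult_right_iff dvd_triv_right)
  then obtain C where C: "Q * T = B * C" by blast
  show ?thesis
  \<comment> \<open>The witnesses, fixed by the final equation, are \<open>p/q\<close> at
    \<open>(u,t)\<close> for \<open>f\<close> and \<open>r/s\<close> at \<open>(v,t)\<close> for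
    \<open>g\<close>.\<close>
  proof (intro exI allI impI)
    fix u v assume u: "alg_independent2 \<iota> u t" and v: "alg_independent2 \<iota> v t"
    interpret e3: comm_ring_morphism "\<lambda>p. eval3 \<iota> p u v t" by (rule eval3_morphism[OF \<iota>])
    have nz: "eval2 \<iota> q u t \<noteq> 0" "eval2 \<iota> s v t \<noteq> 0"
      using u v q' s' PQ RT unfolding alg_independent2_def by auto
    then have Bnz: "eval3 \<iota> B u v t \<noteq> 0"
      using arg_cong[OF C, of "\<lambda>p. eval3 \<iota> p u v t"] by (auto simp: e3.mult q s)
    have "eval3 \<iota> A u v t * (eval2 \<iota> q u t * eval2 \<iota> s v t)
        = (eval2 \<iota> p u t * eval2 \<iota> s v t + eval2 \<iota> r v t * eval2 \<iota> q u t) * eval3 \<iota> B u v t"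
      using arg_cong[OF eq, of "\<lambda>p. eval3 \<iota> p u v t"] by (simp add: e3.mult e3.add p q r s)
    then show "eval3 \<iota> (fst (quot_of_fract H)) u v t / eval3 \<iota> (snd (quot_of_fract H)) u v t
        = eval2 \<iota> p u t / eval2 \<iota> q u t + eval2 \<iota> r v t / eval2 \<iota> s v t"
      using nz Bnz by (simp add: AB add_frac_eq frac_eq_eq)
  qed
qed

text \<open>On each line the factor \<open>f (lab a)\<close> is constant and can be pulled out of
  the sum.\<close>

lemma sum_line_function_eq_0:
  fixes k :: "'e \<Rightarrow> 'c::comm_ring_1"
  assumes fin: "finite E" and 0: "\<And>e. e \<in> E \<Longrightarrow> (\<Sum>a\<in>{a\<in>E. lab a = lab e}. k a) = 0"
  shows "(\<Sum>a\<in>E. k a * f (lab a)) = 0"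
proof -
  have "(\<Sum>a\<in>E. k a * f (lab a)) = (\<Sum>l\<in>lab ` E. \<Sum>a\<in>{a\<in>E. lab a = l}. k a * f (lab a))"
    by (rule sum.image_gen[OF fin])
  also have "\<dots> = (\<Sum>l\<in>lab ` E. (\<Sum>a\<in>{a\<in>E. lab a = l}. k a) * f l)"
    by (auto simp: sum_distrib_right intro!: sum.cong)
  also have "\<dots> = 0" using 0 by (intro sum.neutral) auto
  finally show ?thesis .
qed

text \<open>
  The fraction need not be regular: \<open>frac_at\<close> is then a constant, and the coefficients of a chain with
  vanishing line sums add up to zero.
\<close>
lemma cancels_decoupled_if_line_sums_0:
  assumes \<iota>: "field_embedding \<iota>" and fin: "finite \<S>" "\<S> \<noteq> {}" and w: "\<And>s. s \<in> \<S> \<Longrightarrow> w s \<noteq> 0"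
    and m: "m_x \<S> > 0" "m_y \<S> > 0" "M_x \<S> > 0" "M_y \<S> > 0"
    and ind: "alg_independent2 \<iota> x y"
    and O: "finite (orbit \<iota> \<S> w x y)" "Poly_Mapping.keys \<alpha> \<subseteq> orbit \<iota> \<S> w x y"
    and fst: "\<And>e. e \<in> orbit \<iota> \<S> w x y \<Longrightarrow>
      (\<Sum>a\<in>{a\<in>orbit \<iota> \<S> w x y. fst a = fst e}. Poly_Mapping.lookup \<alpha> a) = 0"
    and snd: "\<And>e. e \<in> orbit \<iota> \<S> w x y \<Longrightarrow>
      (\<Sum>a\<in>{a\<in>orbit \<iota> \<S> w x y. snd a = snd e}. Poly_Mapping.lookup \<alpha> a) = 0"
  shows "cancels_decoupled \<iota> \<S> w x y \<alpha>"
  unfolding cancels_decoupled_def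
proof
  fix H assume H: "H \<in> decoupled_fracs"
  interpret e0: comm_ring_morphism \<iota> by (rule field_embedding_morphism[OF \<iota>])
  let ?E = "orbit \<iota> \<S> w x y"
  define t where "t = 1 / step_poly \<iota> \<S> w x y"
  define k where "k a = \<iota> (Poly_Mapping.lookup \<alpha> a)" for a
  have k: "(\<Sum>a\<in>{a\<in>?E. fst a = fst e}. k a) = 0" "(\<Sum>a\<in>{a\<in>?E. snd a = snd e}. k a) = 0" if "e \<in> ?E" for e
    unfolding k_def e0.sum[symmetric] using fst[OF that] snd[OF that] by (simp_all add: e0.zero)
  have split: "(\<Sum>a\<in>?E. k a * (f (fst a) + g (snd a))) = 0" for f g
    using sum_line_function_eq_0[OF O(1), where lab = fst and k = k and f = f] sum_line_function_eq_0[OF O(1), where lab = snd and k = k and f = g] k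
    by (simp add: distrib_left sum.distrib)
  \<comment> \<open>Pairs outside the support contribute zero, so the sum may run over the orbit, as
    the line sums do.\<close>
  have "frac_at_chain \<iota> \<S> w x y H \<alpha> = (\<Sum>a\<in>?E. k a * frac_at \<iota> \<S> w x y H a)"
    unfolding frac_at_chain_def k_def
    using O by (intro sum.mono_neutral_left) (auto simp: in_keys_iff e0.zero)
  also have "\<dots> = 0"
  proof (cases "regular_frac \<S> w H")
    case False
    then show ?thesis using split[of "\<lambda>_. undefined" "\<lambda>_. 0"]
      by (simp add: frac_at_def case_prod_beta)
  next
    case True
    obtain f g where fg: "\<And>u v. alg_independent2 \<iota> u t \<Longrightarrow> alg_independent2 \<iota> v t \<Longrightarrow>
       eval3 \<iota> (fst (quot_of_fract H)) u v t / eval3 \<iota> (snd (quot_of_fract H)) u v t = f u + g v"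
      using eval_decoupled[OF \<iota> H, of t] by auto
    have "frac_at \<iota> \<S> w x y H a = f (fst a) + g (snd a)" if a: "a \<in> ?E" for a
    proof -
      have ia: "alg_independent2 \<iota> (fst a) (snd a)" "step_poly \<iota> \<S> w (fst a) (snd a) = step_poly \<iota> \<S> w x y"
        using orbit_independent[OF \<iota> fin w m ind a] by auto
      note nz = alg_independent2_nonzero[OF \<iota> ia(1)]
      have "alg_independent2 \<iota> (fst a) t" "alg_independent2 \<iota> (snd a) t"
        \<comment> \<open>As \<open>S\<close> is constant on the orbit, \<open>t\<close> is also the
          inverse of its value at \<open>a\<close>, and independence of \<open>a\<close> passes to
          each coordinate paired with \<open>t\<close>.\<close>
        unfolding t_def ia(2)[symmetric]
        using alg_independent2_step_poly[OF \<iota> fin w _ _ m(4) nz] alg_independent2_step_poly'[OF \<iota> fin w _ _ m(3) nz]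
          m ia(1) by (auto intro!: alg_independent2_inverse[OF \<iota>])
      from fg[OF this] show ?thesis using True by (simp add: frac_at_def case_prod_beta t_def)
    qed
    then show ?thesis using split[of f g] by simp
  qed
  finally show "frac_at_chain \<iota> \<S> w x y H \<alpha> = 0" .
qed

subsection \<open>The action of automorphisms on the orbit\<close>

lemma subfield_set_hull: "subfield_set (subfield_set hull A)"
  by (rule hull_in) (auto simp: subfield_set_def)

lemma subfield_set_closed:
  assumes "subfield_set L"
  shows "a \<in> L \<Longrightarrow> (a::'k::field) ^ n \<in> L" and "a \<in> L \<Longrightarrow> a powi i \<in> L"
    and "(\<And>i. i \<in> I \<Longrightarrow> f i \<in> L) \<Longrightarrow> (\<Sum>i\<in>I. f i) \<in> L"
proof -
  show pow: "a ^ n \<in> L" if "a \<in> L" for n a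
    using that assms by (induction n) (auto simp: subfield_set_def)
  show "a \<in> L \<Longrightarrow> a powi i \<in> L"
    using pow assms by (auto simp: power_int_def subfield_set_def)
  show "(\<And>i. i \<in> I \<Longrightarrow> f i \<in> L) \<Longrightarrow> (\<Sum>i\<in>I. f i) \<in> L"
    using assms by (induction I rule: infinite_finite_induct) (auto simp: subfield_set_def)
qed

text \<open>Automorphisms are given only as additive and multiplicative on \<open>L\<close>. They
  respect 0 and 1 because constants are fixed, and hence inverses, which handles negative
  exponents.\<close>

lemma field_aut_step_poly:
  assumes L: "subfield_set L" and \<sigma>: "\<sigma> \<in> field_aut L F" and F: "range \<iota> \<subseteq> F" "F \<subseteq> L"
    and \<iota>: "field_embedding \<iota>" and uv: "u \<in> L" "v \<in> L"
  shows "\<sigma> (step_poly \<iota> \<S> w u v) = step_poly \<iota> \<S> w (\<sigma> u) (\<sigma> v)"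
proof -
  interpret e0: comm_ring_morphism \<iota> by (rule field_embedding_morphism[OF \<iota>])
  have add: "\<sigma> (a + b) = \<sigma> a + \<sigma> b" and mult: "\<sigma> (a * b) = \<sigma> a * \<sigma> b" if "a \<in> L" "b \<in> L" for a b
    using \<sigma> that unfolding field_aut_def by auto
  have fixed: "\<sigma> (\<iota> c) = \<iota> c" for c
    using \<sigma> subsetD[OF F(1), of "\<iota> c"] unfolding field_aut_def by auto
  have \<iota>L: "\<iota> c \<in> L" for c using F by auto
  have zero: "\<sigma> 0 = 0" and one: "\<sigma> 1 = 1" using fixed[of 0] fixed[of 1] by (simp_all add: e0.zero e0.one)
  have L': "0 \<in> L" "1 \<in> L" "a \<in> L \<Longrightarrow> b \<in> L \<Longrightarrow> a * b \<in> L" "a \<in> L \<Longrightarrow> inverse a \<in> L" for a b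
    using L unfolding subfield_set_def by auto
  note closed = L' subfield_set_closed[OF L]
  have inv: "\<sigma> (inverse a) = inverse (\<sigma> a)" if "a \<in> L" for a
  proof (cases "a = 0")
    case False
    then have "\<sigma> a * \<sigma> (inverse a) = 1" using mult[of a "inverse a"] that closed one by simp
    then show ?thesis by (metis inverse_unique)
  qed (simp add: zero)
  have pow: "\<sigma> (a ^ n) = \<sigma> a ^ n" if "a \<in> L" for a n
    using that by (induction n) (simp_all add: one mult closed)
  have powi: "\<sigma> (a powi i) = \<sigma> a powi i" if "a \<in> L" for a i
    using that by (simp add: power_int_def pow inv closed)
  have sum: "\<sigma> (\<Sum>i\<in>I. f i) = (\<Sum>i\<in>I. \<sigma> (f i))" if "\<And>i. i \<in> I \<Longrightarrow> f i \<in> L" for I and f :: "int \<times> int \<Rightarrow> 'a"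
    using that by (induction I rule: infinite_finite_induct) (simp_all add: zero add closed)
  show ?thesis
    unfolding step_poly_def case_prod_beta
    by (subst sum) (simp_all add: closed \<iota>L uv mult powi fixed)
qed

lemma orbit_coordinates_in_field:
  "a \<in> orbit \<iota> \<S> w x y \<Longrightarrow> fst a \<in> orbit_field \<iota> \<S> w x y \<and> snd a \<in> orbit_field \<iota> \<S> w x y"
  unfolding orbit_field_def by (blast intro: hull_inc)

text \<open>The variable \<open>z\<close> covers both Galois groups at once. A path from
  \<open>(x,y)\<close> to \<open>a\<close> is mapped to a path from the image of
  \<open>(x,y)\<close>, which is itself related to \<open>(x,y)\<close>.\<close>

lemma field_aut_orbit:
  fixes \<iota> :: "complex \<Rightarrow> 'k::field"
  assumes \<iota>: "field_embedding \<iota>" and xy: "x \<noteq> 0" "y \<noteq> 0"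
    and z: "z = x \<or> z = y"
    and \<sigma>: "\<sigma> \<in> field_aut (orbit_field \<iota> \<S> w x y) (subfield_set hull (base_field \<iota> \<S> w x y \<union> {z}))"
    and a: "a \<in> orbit \<iota> \<S> w x y"
  shows "map_prod \<sigma> \<sigma> a \<in> orbit \<iota> \<S> w x y"
proof -
  define L where "L = orbit_field \<iota> \<S> w x y"
  define F where "F = subfield_set hull (base_field \<iota> \<S> w x y \<union> {z})"
  have \<sigma>': "\<sigma> \<in> field_aut L F" using \<sigma> by (simp add: L_def F_def)
  have L: "subfield_set L" unfolding L_def orbit_field_def by (rule subfield_set_hull)
  have baseF: "base_field \<iota> \<S> w x y \<subseteq> F" "z \<in> F" unfolding F_def by (auto intro: hull_inc)
  have \<iota>F: "range \<iota> \<subseteq> F" and sF: "step_poly \<iota> \<S> w x y \<in> F"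
    using baseF(1) unfolding base_field_def by (auto dest: subsetD[OF _ hull_inc])
  have xyL: "x \<in> L" "y \<in> L"
    using orbit_coordinates_in_field[of "(x, y)" \<iota> \<S> w x y] by (simp_all add: L_def orbit_def)
  have "base_field \<iota> \<S> w x y \<subseteq> L" unfolding L_def orbit_field_def by (auto intro: hull_inc)
  then have FL: "F \<subseteq> L" unfolding F_def using z xyL by (intro hull_minimal[of _ L]) (auto simp: L)
  have fixed: "\<sigma> c = c" if "c \<in> F" for c using \<sigma>' that unfolding field_aut_def by auto
  have inj: "inj_on \<sigma> L" using \<sigma>' unfolding field_aut_def bij_betw_def by auto
  \<comment> \<open>The relations demand nonzero coordinates; injectivity and
    \<open>\<sigma> 0 = 0\<close> preserve this.\<close>
  have "0 \<in> F" unfolding F_def using subfield_set_hull unfolding subfield_set_def by blast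
  then have nz: "\<sigma> c \<noteq> 0" if "c \<in> L" "c \<noteq> 0" for c
    using that inj fixed[of 0] FL by (metis inj_onD subsetD)
  have S: "\<sigma> (step_poly \<iota> \<S> w u v) = step_poly \<iota> \<S> w (\<sigma> u) (\<sigma> v)" if "u \<in> L" "v \<in> L" for u v
    by (rule field_aut_step_poly[OF L \<sigma>' \<iota>F FL \<iota> that])
  let ?r = "\<lambda>b c. sim_x \<iota> \<S> w b c \<or> sim_y \<iota> \<S> w b c"
  have a': "equivclp ?r (x, y) a" using a by (simp add: orbit_def)
  then have "equivclp ?r (x, y) (map_prod \<sigma> \<sigma> a)"
  proof (induction rule: equivclp_induct)
    case base
    \<comment> \<open>Both \<open>z\<close> and \<open>S(x,y)\<close> are fixed, so
      \<open>(x,y)\<close> and its image share a coordinate and the value of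
      \<open>S\<close>.\<close>
    have "step_poly \<iota> \<S> w (\<sigma> x) (\<sigma> y) = step_poly \<iota> \<S> w x y"
      using S[OF xyL] fixed[OF sF] by simp
    moreover have "\<sigma> x = x \<or> \<sigma> y = y" using fixed baseF z by auto
    ultimately have "?r (x, y) (\<sigma> x, \<sigma> y)"
      using xy nz xyL unfolding sim_x_def sim_y_def by auto
    then show ?case by (auto intro: r_into_equivclp)
  next
    case (step b c)
    have "equivclp ?r (x, y) c" using step equivclp_into_equivclp[OF step(1,2)] by simp
    then have L: "fst b \<in> L" "snd b \<in> L" "fst c \<in> L" "snd c \<in> L"
      using orbit_coordinates_in_field[of _ \<iota> \<S> w x y] step(1) unfolding L_def orbit_def by auto
    obtain u v u' v' where bc: "b = (u, v)" "c = (u', v')" by fastforce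
    have bc0: "u \<noteq> 0" "v \<noteq> 0" "u' \<noteq> 0" "v' \<noteq> 0" and share: "u = u' \<or> v = v'"
      and eq: "step_poly \<iota> \<S> w u v = step_poly \<iota> \<S> w u' v'"
      using step(2) by (auto simp: bc sim_x_def sim_y_def)
    have "step_poly \<iota> \<S> w (\<sigma> u) (\<sigma> v) = step_poly \<iota> \<S> w (\<sigma> u') (\<sigma> v')"
      using eq S[of u v] S[of u' v'] L by (simp add: bc)
    then have "?r (map_prod \<sigma> \<sigma> b) (map_prod \<sigma> \<sigma> c) \<or> ?r (map_prod \<sigma> \<sigma> c) (map_prod \<sigma> \<sigma> b)"
      using bc0 share nz L unfolding sim_x_def sim_y_def by (auto simp: bc)
    then show ?case using equivclp_into_equivclp[OF step.IH] by blast
  qed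
  then show ?thesis by (simp add: orbit_def)
qed


text \<open>The passage from Galois theory to the graph: being injective on the orbit field,
  \<open>\<sigma>\<close> preserves and reflects equality of coordinates, and fixing
  \<open>z\<close> it stabilises that vertex. \<open>restrict\<close> provides the extensionality
  required by \<open>line_auts\<close>.\<close>

lemma field_aut_line_auts:
  fixes \<iota> :: "complex \<Rightarrow> 'k::field"
  assumes \<iota>: "field_embedding \<iota>" and xy: "x \<noteq> 0" "y \<noteq> 0"
    and z: "z = x \<or> z = y"
    and \<sigma>: "\<sigma> \<in> field_aut (orbit_field \<iota> \<S> w x y) (subfield_set hull (base_field \<iota> \<S> w x y \<union> {z}))"
    and fin: "finite (orbit \<iota> \<S> w x y)"
  shows "bij_betw (map_prod \<sigma> \<sigma>) (orbit \<iota> \<S> w x y) (orbit \<iota> \<S> w x y)"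
    and "z = x \<Longrightarrow> restrict (map_prod \<sigma> \<sigma>) (orbit \<iota> \<S> w x y) \<in> line_auts (orbit \<iota> \<S> w x y) (\<lambda>a. fst a = x)"
    and "z = y \<Longrightarrow> restrict (map_prod \<sigma> \<sigma>) (orbit \<iota> \<S> w x y) \<in> line_auts (orbit \<iota> \<S> w x y) (\<lambda>a. snd a = y)"
proof -
  let ?E = "orbit \<iota> \<S> w x y" and ?L = "orbit_field \<iota> \<S> w x y"
  have inj: "\<sigma> c = \<sigma> d \<longleftrightarrow> c = d" if "c \<in> ?L" "d \<in> ?L" for c d
    using \<sigma> that unfolding field_aut_def by (auto simp: bij_betw_def inj_on_eq_iff)
  have L: "fst a \<in> ?L" "snd a \<in> ?L" if "a \<in> ?E" for a
    using orbit_coordinates_in_field[OF that] by auto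
  have "(x, y) \<in> ?E" by (simp add: orbit_def)
  then have xyL: "x \<in> ?L" "y \<in> ?L" using L by force+
  have \<sigma>z: "\<sigma> z = z" using \<sigma> unfolding field_aut_def by (auto simp: hull_inc)
  have fix_z: "\<sigma> c = z \<longleftrightarrow> c = z" if "c \<in> ?L" for c
    using inj[OF that, of z] z xyL \<sigma>z by auto
  have "inj_on (map_prod \<sigma> \<sigma>) ?E"
  proof (rule inj_onI)
    fix a b assume ab: "a \<in> ?E" "b \<in> ?E" and eq: "map_prod \<sigma> \<sigma> a = map_prod \<sigma> \<sigma> b"
    have "\<sigma> (fst a) = \<sigma> (fst b)" "\<sigma> (snd a) = \<sigma> (snd b)"
      using arg_cong[OF eq, of fst] arg_cong[OF eq, of snd] by simp_all
    then show "a = b"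
      by (simp add: prod_eq_iff inj[OF L(1)[OF ab(1)] L(1)[OF ab(2)]] inj[OF L(2)[OF ab(1)] L(2)[OF ab(2)]])
  qed
  moreover have "map_prod \<sigma> \<sigma> ` ?E \<subseteq> ?E" by (intro image_subsetI field_aut_orbit[OF \<iota> xy z \<sigma>])
  ultimately show bij: "bij_betw (map_prod \<sigma> \<sigma>) ?E ?E"
    using fin by (simp add: bij_betw_def endo_inj_surj)
  then have bij': "bij_betw (restrict (map_prod \<sigma> \<sigma>) ?E) ?E ?E"
    by (simp cong: bij_betw_cong)
  show "restrict (map_prod \<sigma> \<sigma>) ?E \<in> line_auts ?E (\<lambda>a. fst a = x)" if "z = x"
    using bij' fix_z that by (simp add: line_auts_def inj L)
  show "restrict (map_prod \<sigma> \<sigma>) ?E \<in> line_auts ?E (\<lambda>a. snd a = y)" if "z = y"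
    using bij' fix_z that by (simp add: line_auts_def inj L)
qed

section \<open>Rational functions on the orbit as chains\<close>

definition chain_of :: "'e set \<Rightarrow> ('e \<Rightarrow> rat) \<Rightarrow> 'e \<Rightarrow>\<^sub>0 complex" where
  "chain_of E f = (\<Sum>a\<in>E. Poly_Mapping.single a (of_rat (f a)))"

lemma lookup_chain_of:
  "finite E \<Longrightarrow> Poly_Mapping.lookup (chain_of E f) a = (if a \<in> E then of_rat (f a) else 0)"
  by (simp add: chain_of_def lookup_sum lookup_single when_def)

lemma keys_chain_of: "finite E \<Longrightarrow> Poly_Mapping.keys (chain_of E f) \<subseteq> E"
  by (auto simp: in_keys_iff lookup_chain_of split: if_splits)

lemma rational_coeffs_chain_of: "finite E \<Longrightarrow> rational_coeffs (chain_of E f)"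
  by (simp add: rational_coeffs_def lookup_chain_of)

text \<open>The action moves coefficients along a permutation of \<open>E\<close>; since
  \<open>f\<close> is constant along it, reindexing returns the same chain.\<close>

lemma chain_act_chain_of:
  assumes fin: "finite E" and bij: "bij_betw (map_prod \<sigma> \<sigma>) E E"
    and f: "\<And>a. a \<in> E \<Longrightarrow> f (map_prod \<sigma> \<sigma> a) = f a"
  shows "chain_act \<sigma> (chain_of E f) = chain_of E f"
proof -
  have "chain_act \<sigma> (chain_of E f)
      = (\<Sum>a\<in>E. Poly_Mapping.single (map_prod \<sigma> \<sigma> a) (Poly_Mapping.lookup (chain_of E f) a))"
    unfolding chain_act_def using fin keys_chain_of[OF fin, of f]
    by (intro sum.mono_neutral_left) (auto simp: in_keys_iff)
  also have "\<dots> = (\<Sum>a\<in>E. Poly_Mapping.single (map_prod \<sigma> \<sigma> a) (of_rat (f (map_prod \<sigma> \<sigma> a))))"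
    using fin by (intro sum.cong) (auto simp: lookup_chain_of f)
  also have "\<dots> = chain_of E f"
    unfolding chain_of_def
    using sum.reindex_bij_betw[OF bij, of "\<lambda>a. Poly_Mapping.single a (of_rat (f a))"] .
  finally show ?thesis .
qed

theorem mainTheorem4:
  fixes \<S> :: "(int \<times> int) set" and w :: "int \<times> int \<Rightarrow> complex"
    and \<iota> :: "complex \<Rightarrow> 'k::alg_closed_field" and x y :: 'k
  assumes "finite \<S>" and "\<S> \<noteq> {}" and "\<And>s. s \<in> \<S> \<Longrightarrow> w s \<noteq> 0"
    and "m_x \<S> > 0" and "M_x \<S> > 0" and "m_y \<S> > 0" and "M_y \<S> > 0"
    and "field_embedding \<iota>"
    and "alg_independent2 \<iota> x y"
    and "\<And>z. algebraic_over (subfield_set hull (range \<iota> \<union> {x, y})) z"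
    and "finite (orbit \<iota> \<S> w x y)"
  shows "\<exists>\<gamma>\<^sub>x \<gamma>\<^sub>y \<alpha>.
      \<gamma>\<^sub>x \<in> zero_chains \<iota> \<S> w x y \<and> \<gamma>\<^sub>y \<in> zero_chains \<iota> \<S> w x y \<and> \<alpha> \<in> zero_chains \<iota> \<S> w x y \<and>
      rational_coeffs \<gamma>\<^sub>x \<and> rational_coeffs \<gamma>\<^sub>y \<and> rational_coeffs \<alpha> \<and>
      Poly_Mapping.single (x, y) 1 = \<gamma>\<^sub>x + \<gamma>\<^sub>y + \<alpha> \<and>
      (\<forall>\<sigma>\<in>G_x \<iota> \<S> w x y. chain_act \<sigma> \<gamma>\<^sub>x = \<gamma>\<^sub>x) \<and>
      (\<forall>\<sigma>\<in>G_y \<iota> \<S> w x y. chain_act \<sigma> \<gamma>\<^sub>y = \<gamma>\<^sub>y) \<and>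
      cancels_decoupled \<iota> \<S> w x y \<alpha>"
proof -
  let ?E = "orbit \<iota> \<S> w x y"
  let ?r = "\<lambda>b c. sim_x \<iota> \<S> w b c \<or> sim_y \<iota> \<S> w b c"
  note fin = assms(11)
  have share: "fst a = fst b \<or> snd a = snd b" if "?r a b" for a b
    using that unfolding sim_x_def sim_y_def by auto
  have E: "?E = {a. equivclp ?r (x, y) a}" by (simp add: orbit_def)
  have xyE: "(x, y) \<in> ?E" by (simp add: orbit_def)
  note xy = alg_independent2_nonzero[OF assms(8,9)]
  obtain g h k :: "'k \<times> 'k \<Rightarrow> rat" where
    sum: "\<forall>a\<in>?E. of_bool (a = (x, y)) = g a + h a + k a"
    and g: "\<forall>p\<in>line_auts ?E (\<lambda>a. fst a = fst (x, y)). \<forall>a\<in>?E. g (p a) = g a"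
    and h: "\<forall>p\<in>line_auts ?E (\<lambda>a. snd a = snd (x, y)). \<forall>a\<in>?E. h (p a) = h a"
    and k1: "\<forall>e\<in>?E. (\<Sum>a\<in>{a\<in>?E. fst a = fst e}. k a) = 0"
    and k2: "\<forall>e\<in>?E. (\<Sum>a\<in>{a\<in>?E. snd a = snd e}. k a) = 0"
    using connected_decoupling[OF share E fin] by blast
  note lookup = lookup_chain_of[OF fin]
  \<comment> \<open>As \<open>of_rat\<close> commutes with sums, the vanishing line sums of
    \<open>k\<close> carry over to its complex chain.\<close>
  have line: "(\<Sum>a\<in>{a\<in>?E. P a}. Poly_Mapping.lookup (chain_of ?E k) a) = of_rat (\<Sum>a\<in>{a\<in>?E. P a}. k a)" for P
    by (auto simp: of_rat_sum lookup intro!: sum.cong)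
  show ?thesis
  proof (intro exI conjI ballI)
    show "Poly_Mapping.single (x, y) 1 = chain_of ?E g + chain_of ?E h + chain_of ?E k"
    proof (rule poly_mapping_eqI)
      fix a
      have "of_rat (g a) + of_rat (h a) + of_rat (k a) = (of_bool (a = (x, y)) :: complex)" if "a \<in> ?E"
        using arg_cong[OF bspec[OF sum that], of "of_rat :: rat \<Rightarrow> complex"]
        by (simp add: of_rat_add of_bool_def split: if_splits)
      then show "Poly_Mapping.lookup (Poly_Mapping.single (x, y) 1) a
          = Poly_Mapping.lookup (chain_of ?E g + chain_of ?E h + chain_of ?E k) a"
        using xyE by (auto simp: lookup_add lookup lookup_single when_def)
    qed
    show "chain_act \<sigma> (chain_of ?E g) = chain_of ?E g" if "\<sigma> \<in> G_x \<iota> \<S> w x y" for \<sigma>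
    proof (rule chain_act_chain_of[OF fin])
      \<comment> \<open>Elements of \<open>G_x\<close> act on the orbit as line automorphisms
        stabilising \<open>x\<close>, under which \<open>g\<close> is invariant.\<close>
      note aut = field_aut_line_auts[OF assms(8) xy _ that[unfolded G_x_def] fin]
      show "bij_betw (map_prod \<sigma> \<sigma>) ?E ?E" by (rule aut) simp
      show "g (map_prod \<sigma> \<sigma> a) = g a" if "a \<in> ?E" for a
        using bspec[OF bspec[OF g, of "restrict (map_prod \<sigma> \<sigma>) ?E"] that] aut(2) that by simp
    qed
    show "chain_act \<sigma> (chain_of ?E h) = chain_of ?E h" if "\<sigma> \<in> G_y \<iota> \<S> w x y" for \<sigma>
    proof (rule chain_act_chain_of[OF fin])
      note aut = field_aut_line_auts[OF assms(8) xy _ that[unfolded G_y_def] fin]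
      show "bij_betw (map_prod \<sigma> \<sigma>) ?E ?E" by (rule aut) simp
      show "h (map_prod \<sigma> \<sigma> a) = h a" if "a \<in> ?E" for a
        using bspec[OF bspec[OF h, of "restrict (map_prod \<sigma> \<sigma>) ?E"] that] aut(3) that by simp
    qed
    show "cancels_decoupled \<iota> \<S> w x y (chain_of ?E k)"
      by (rule cancels_decoupled_if_line_sums_0[OF assms(8,1,2,3,4,6,5,7,9) fin])
         (simp_all add: keys_chain_of[OF fin] line k1 k2)
  qed (simp_all add: zero_chains_def keys_chain_of rational_coeffs_chain_of fin)
qed

end
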